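(* Let $x^0\in L^\infty(I,\mathbb{R}^d)$ be such that $\|x^0\|_{L^\infty(I,\mathbb{R}^d)}\leq R$ for some $R>0$. Let $a:\mathbb{R}_+\times I\times I\to[0,1]$ be Lebesgue measurable and let $\phi:\mathbb{R}_+\to(0,+\infty)$ be locally Lipschitz continuous, positive and bounded. Denote by $x(\cdot)\in\mathrm{Lip}_{\mathrm{loc}}(\mathbb{R}_+,L^2(I,\mathbb{R}^d))$ the corresponding solution of $$\partial_t x(t,i)=\int_I a(t,i,j)\,\phi(|x(t,i)-x(t,j)|)\,(x(t,j)-x(t,i))\,\mathrm{d}j,\qquad x(0)=x^0 .$$ Suppose that there exist $\tau>0$ and $\mu\in(0,1]$ such that $$\frac1\tau\int_t^{t+\tau}\int_I a(s,i,j)\,\mathrm{d}j\,\mathrm{d}s\geq\mu$$ for all times $t\geq 0$ and almost every $i\in I$. Then, for any given element $x^\infty\in\mathcal{C}(x^0)$, one has $$\|x(t)-x^\infty\|_{L^\infty(I,\mathbb{R}^d)}\underset{t\to+\infty}{\longrightarrow}0\qquad\text{if and only if}\qquad\|x(t)-x^\infty\|_{L^2(I,\mathbb{R}^d)}\underset{t\to+\infty}{\longrightarrow}0 .$$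
   Context: $I:=[0,1]$ with the Lebesgue measure, $d\geq 1$ is an integer, $\mathbb{R}_+=[0,+\infty)$. The graphon dynamics is understood for almost every $t\geq 0$ and almost every $i\in I$. $\mathcal{C}(x^0)\subset\mathbb{R}^d$ is the closed convex hull of the essential range of $x^0$; an element of $\mathbb{R}^d$ is identified with the corresponding constant function on $I$. *)

theory Defs
  imports "HOL-Analysis.Analysis" "HOL-Probability.Essential_Supremum"
begin

text \<open>
  Elements of the Lebesgue spaces are represented by functions; equality in these spaces is
  equality almost everywhere. All notions below are invariant under changing the
  representatives on null sets.
\<close>

abbreviation I_leb :: "real measure" where
  "I_leb \<equiv> lebesgue_on {0..1}"

definition L2_space :: "'a measure \<Rightarrow> ('a \<Rightarrow> 'b::euclidean_space) set" where
  "L2_space M = {f \<in> borel_measurable M. integrable M (\<lambda>i. (norm (f i))\<^sup>2)}"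

text \<open>Only meaningful on \<^const>\<open>L2_space\<close>: the Bochner integral of a non-integrable function is 0.\<close>

definition L2_norm :: "'a measure \<Rightarrow> ('a \<Rightarrow> 'b::euclidean_space) \<Rightarrow> real" where
  "L2_norm M f = sqrt (\<integral>i. (norm (f i))\<^sup>2 \<partial>M)"

text \<open>Takes the value \<open>\<infinity>\<close> on measurable functions that are not essentially bounded.\<close>

definition Linf_norm :: "'a measure \<Rightarrow> ('a \<Rightarrow> 'b::euclidean_space) \<Rightarrow> ereal" where
  "Linf_norm M f = esssup M (\<lambda>i. ereal (norm (f i)))"

definition Linf_space :: "'a measure \<Rightarrow> ('a \<Rightarrow> 'b::euclidean_space) set" where
  "Linf_space M = {f \<in> borel_measurable M. Linf_norm M f < \<infinity>}"

definition ess_range :: "'a measure \<Rightarrow> ('a \<Rightarrow> 'b::euclidean_space) \<Rightarrow> 'b set" where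
  "ess_range M f = {y. \<forall>e>0. emeasure M {i \<in> space M. dist (f i) y < e} > 0}"

definition closed_convex_hull_ess_range :: "(real \<Rightarrow> 'b::euclidean_space) \<Rightarrow> 'b set" where
  "closed_convex_hull_ess_range x0 = closure (convex hull (ess_range I_leb x0))"

definition locally_lipschitz_on :: "'a::metric_space set \<Rightarrow> ('a \<Rightarrow> 'b::metric_space) \<Rightarrow> bool" where
  "locally_lipschitz_on S f \<longleftrightarrow> (\<forall>r\<in>S. \<exists>u>0. \<exists>L. L-lipschitz_on (cball r u \<inter> S) f)"

text \<open>The space \<open>Lip\<^sub>l\<^sub>o\<^sub>c(\<real>\<^sub>+, L\<^sup>2(I))\<close>.\<close>

definition Lip_loc_L2 :: "(real \<Rightarrow> real \<Rightarrow> 'b::euclidean_space) set" where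
  "Lip_loc_L2 = {x. (\<forall>t\<ge>0. x t \<in> L2_space I_leb) \<and>
     (\<forall>t\<ge>0. \<exists>u>0. \<exists>L\<ge>0. \<forall>r\<in>cball t u \<inter> {0..}. \<forall>s\<in>cball t u \<inter> {0..}.
        L2_norm I_leb (\<lambda>i. x r i - x s i) \<le> L * dist r s)}"

text \<open>\<open>v\<close> is the derivative at \<open>t\<close> of the curve \<open>x : \<real>\<^sub>+ \<rightarrow> L\<^sup>2(I)\<close>, in the norm of \<open>L\<^sup>2(I)\<close>.\<close>

definition has_L2_time_derivative ::
  "(real \<Rightarrow> real \<Rightarrow> 'b::euclidean_space) \<Rightarrow> (real \<Rightarrow> 'b) \<Rightarrow> real \<Rightarrow> bool" where
  "has_L2_time_derivative x v t \<longleftrightarrow> v \<in> L2_space I_leb \<and>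
     ((\<lambda>s. L2_norm I_leb (\<lambda>i. (x s i - x t i) /\<^sub>R (s - t) - v i)) \<longlongrightarrow> 0) (at t within {0..})"

text \<open>
  \<open>\<partial>\<^sub>t x(t,i)\<close> is the value at \<open>i\<close> of the time derivative of the \<open>L\<^sup>2\<close>-valued curve. The values
  \<open>x t i\<close> for individual \<open>t\<close> and \<open>i\<close> depend on the representatives of the classes \<open>x(t)\<close>, so a
  pointwise time derivative would not be well defined.
\<close>

definition graphon_solution ::
  "(real \<Rightarrow> real \<Rightarrow> real \<Rightarrow> real) \<Rightarrow> (real \<Rightarrow> real) \<Rightarrow> (real \<Rightarrow> 'b::euclidean_space) \<Rightarrow>
   (real \<Rightarrow> real \<Rightarrow> 'b) \<Rightarrow> bool" where
  "graphon_solution a \<phi> x0 x \<longleftrightarrow>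
     x \<in> Lip_loc_L2 \<and>
     (AE i in I_leb. x 0 i = x0 i) \<and>
     (AE t in lebesgue_on {0..}. \<exists>v. has_L2_time_derivative x v t \<and>
        (AE i in I_leb.
           integrable I_leb (\<lambda>j. (a t i j * \<phi> (norm (x t i - x t j))) *\<^sub>R (x t j - x t i)) \<and>
           v i = (\<integral>j. (a t i j * \<phi> (norm (x t i - x t j))) *\<^sub>R (x t j - x t i) \<partial>I_leb)))"

end

theory Submission
  imports Defs "HOL-Probability.Probability_Measure"
begin

text \<open>
  Fix \<open>c = x\<^sup>\<infinity>\<close>. Convergence in \<open>L\<^sup>\<infinity>\<close> implies convergence in \<open>L\<^sup>2\<close> because \<open>I\<close> has measure one.
  Conversely, the functions \<open>s(t,i) = |x(t,i) - c|\<^sup>2\<close> satisfy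
  \<open>\<partial>\<^sub>t s(t,i) \<le> C \<eta> - 2 \<kappa> b(t,i) s(t,i)\<close> once \<open>\<parallel>x(t) - c\<parallel> \<le> \<eta>\<close> in \<open>L\<^sup>2\<close>, where
  \<open>b(t,i) = \<integral> a(t,i,j) dj\<close> is the degree and \<open>\<kappa> > 0\<close> is a lower bound of \<open>\<phi>\<close> on the bounded set of
  distances that occur (a maximum principle in each half-space bounds the solution).
  By persistence, \<open>s\<close> shrinks over each window of length \<open>\<tau>\<close> by the factor
  \<open>1 / (1 + 2 \<kappa> \<mu> \<tau>)\<close> up to an error \<open>C \<eta> \<tau>\<close>, uniformly in \<open>i\<close>.

  The solution is only a curve in \<open>L\<^sup>2\<close>, so no inequality can be integrated in time for fixed \<open>i\<close>.
  Instead, functionals \<open>t \<mapsto> \<integral> \<theta>(i) g(x(t,i)) di\<close> are locally Lipschitz with an explicit derivative almost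
  everywhere, and pointwise statements are recovered by varying the weight \<open>\<theta>\<close>.
\<close>

section \<open>Integration of differential inequalities for Lipschitz functions\<close>


text \<open>Forward difference quotients of \<open>F\<close> are bounded by \<open>L\<close> and
  converge almost everywhere, so dominated convergence applies to their integrals. The same
  integrals are difference quotients of a primitive of \<open>F\<close> at the two ends, with limit
  \<open>F b - F a\<close>. The room between \<open>b\<close> and \<open>c\<close> keeps forward
  quotients at \<open>b\<close> inside the domain.\<close>

lemma lipschitz_integral_bound:
  fixes F r :: "real \<Rightarrow> real"
  assumes ab: "a \<le> b" "b < c" and L: "L-lipschitz_on {a..c} F"
    and r: "integrable (lebesgue_on {a..b}) r"
    and D: "AE t in lebesgue_on {a..b}. \<exists>D. (F has_real_derivative D) (at t within {a..c}) \<and> D \<le> r t"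
  shows "F b - F a \<le> (\<integral>t. r t \<partial>lebesgue_on {a..b})"
proof -
  let ?M = "lebesgue_on {a..b}"
  \<comment> \<open>The steps tend to zero and never exceed \<open>c - b\<close>, so
    \<open>t + h n\<close> stays in \<open>{a..c}\<close> for every \<open>t\<close> in
    \<open>{a..b}\<close>.\<close>
  define h where "h n = (c - b) / real (Suc n)" for n
  have h: "0 < h n" "h n \<le> c - b" for n
  proof -
    have "(c - b) * 1 \<le> (c - b) * real (Suc n)"
      using ab by (intro mult_left_mono) auto
    then have "h n \<le> c - b"
      unfolding h_def by (subst pos_divide_le_eq) auto
    moreover have "0 < h n"
      using ab by (simp add: h_def)
    ultimately show "0 < h n" "h n \<le> c - b" by auto
  qed
  have h_lim: "h \<longlonglongrightarrow> 0"
    unfolding h_def using LIMSEQ_inverse_real_of_nat tendsto_mult_right_zero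
    by (auto simp: divide_inverse)
  define q where "q n t = (F (t + h n) - F t) / h n" for n t
  have cont: "continuous_on {a..c} F"
    using L lipschitz_on_continuous_on by blast
  have cont_shift: "continuous_on {a..b} (\<lambda>t. F (t + h n))" for n
    by (rule continuous_on_compose2[OF cont]) (use ab h[of n] in \<open>auto intro!: continuous_intros\<close>)
  have cont': "continuous_on {a..b} F"
    using cont ab by (auto elim: continuous_on_subset)
  have q_cont: "continuous_on {a..b} (q n)" for n
    unfolding q_def using h[of n] by (intro continuous_intros cont_shift cont') auto
  have q_meas [measurable]: "q n \<in> borel_measurable ?M" for n
    using q_cont by (intro continuous_imp_measurable_on_sets_lebesgue) auto
  have q_bound: "\<bar>q n t\<bar> \<le> L" if "t \<in> {a..b}" for n t
  proof -
    have "dist (F (t + h n)) (F t) \<le> L * dist (t + h n) t"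
      using that h[of n] ab by (intro lipschitz_onD[OF L]) auto
    then show ?thesis
      using h[of n] by (simp add: q_def dist_real_def abs_divide field_simps)
  qed
  \<comment> \<open>As a pointwise limit of continuous quotients, \<open>D\<close> is measurable; it
    equals the derivative wherever that exists.\<close>
  define D where "D t = lim (\<lambda>n. q n t)" for t
  have [measurable]: "D \<in> borel_measurable ?M"
    unfolding D_def by (rule borel_measurable_lim_metric) (use q_meas in auto)
  have q_lim: "(\<lambda>n. q n t) \<longlonglongrightarrow> D'"
    if "(F has_real_derivative D') (at t within {a..c})" "t \<in> {a..b}" for t D'
  proof -
    have "((\<lambda>s. (F s - F t) / (s - t)) \<longlongrightarrow> D') (at t within {a..c})"
      using that by (simp add: has_field_derivative_iff)
    moreover have "filterlim (\<lambda>n. t + h n) (at t within {a..c}) sequentially"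
      unfolding filterlim_at using h ab that h_lim
      by (auto intro!: always_eventually tendsto_eq_intros) (smt (verit) h)+
    ultimately show ?thesis
      unfolding q_def by (auto dest: filterlim_compose simp: o_def)
  qed
  have "AE t in ?M. t \<in> {a..b}"
    by (auto intro: AE_I2)
  with D have lims: "AE t in ?M. (\<lambda>n. q n t) \<longlonglongrightarrow> D t \<and> D t \<le> r t"
  proof eventually_elim
    case (elim t)
    then obtain D' where "(F has_real_derivative D') (at t within {a..c})" "D' \<le> r t" by blast
    with q_lim[of D' t] elim show ?case
      by (auto simp: D_def limI)
  qed
  have "(\<lambda>n. \<integral>t. q n t \<partial>?M) \<longlonglongrightarrow> (\<integral>t. D t \<partial>?M)"
    and D_int: "integrable ?M D"
  proof -
    have "integrable ?M (\<lambda>_. L)" by simp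
    moreover have "AE t in ?M. (\<lambda>n. q n t) \<longlonglongrightarrow> D t" using lims by auto
    moreover have "AE t in ?M. norm (q n t) \<le> L" for n
      using q_bound by (intro AE_I2) auto
    ultimately show "(\<lambda>n. \<integral>t. q n t \<partial>?M) \<longlonglongrightarrow> (\<integral>t. D t \<partial>?M)" "integrable ?M D"
      by (intro integral_dominated_convergence[of D ?M q "\<lambda>_. L"]
        integrable_dominated_convergence[of D ?M q "\<lambda>_. L"]; simp)+
  qed
  moreover have "(\<lambda>n. \<integral>t. q n t \<partial>?M) \<longlonglongrightarrow> F b - F a"
  proof -
    \<comment> \<open>In terms of the primitive \<open>G\<close>, a shift of the variable and
      cancellation turn the integral of \<open>q n\<close> into the quotient of \<open>G\<close> at
      \<open>b\<close> minus the one at \<open>a\<close>.\<close>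
    define G where "G t = integral {a..t} F" for t
    have G: "(G has_real_derivative F t) (at t within {a..c})" if "t \<in> {a..c}" for t
      unfolding G_def using integral_has_real_derivative[OF cont that] .
    have *: "(\<lambda>n. (G (t + h n) - G t) / h n) \<longlonglongrightarrow> F t" if "t \<in> {a..b}" for t
    proof -
      have "((\<lambda>s. (G s - G t) / (s - t)) \<longlongrightarrow> F t) (at t within {a..c})"
        using G[of t] that ab by (simp add: has_field_derivative_iff)
      moreover have "filterlim (\<lambda>n. t + h n) (at t within {a..c}) sequentially"
        unfolding filterlim_at using h ab that h_lim
        by (auto intro!: always_eventually tendsto_eq_intros) (smt (verit) h)+
      ultimately show ?thesis
        by (auto dest: filterlim_compose simp: o_def)
    qed
    have "(\<integral>t. q n t \<partial>?M) = (G (b + h n) - G b) / h n - (G (a + h n) - G a) / h n" for n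
    proof -
      have "(\<integral>t. q n t \<partial>?M) = integral {a..b} (q n)"
        using q_cont by (intro lebesgue_integral_eq_integral)
          (auto intro: continuous_imp_integrable_real)
      also have "\<dots> = (integral {a..b} (\<lambda>t. F (t + h n)) - integral {a..b} F) / h n"
        unfolding q_def
        by (simp add: integral_diff integrable_continuous_interval cont_shift cont')
      also have "integral {a..b} (\<lambda>t. F (t + h n)) = integral {a + h n..b + h n} F"
      proof -
        have "continuous_on {a + h n..b + h n} F"
          using cont h[of n] ab by (auto elim: continuous_on_subset)
        from integral_shift[OF this] show ?thesis by (simp add: o_def)
      qed
      also have "\<dots> = G (b + h n) - G (a + h n)"
      proof -
        have "F integrable_on {a..b + h n}"
          using cont h[of n] ab by (intro integrable_continuous_interval) (auto elim: continuous_on_subset)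
        then have "integral {a..a + h n} F + integral {a + h n..b + h n} F = integral {a..b + h n} F"
          using h[of n] ab by (intro Henstock_Kurzweil_Integration.integral_combine) auto
        then show ?thesis by (simp add: G_def)
      qed
      also have "integral {a..b} F = G b - G a" by (simp add: G_def)
      finally show ?thesis by (simp add: diff_divide_distrib)
    qed
    then show ?thesis using tendsto_diff[OF *[of b] *[of a]] ab by simp
  qed
  ultimately have "F b - F a = (\<integral>t. D t \<partial>?M)" using LIMSEQ_unique by blast
  also have "\<dots> \<le> (\<integral>t. r t \<partial>?M)"
    using lims by (intro integral_mono_AE D_int r) auto
  finally show ?thesis .
qed

text \<open>Integrability comes from \<open>2 * \<bar>f i * g i\<bar> \<le> (f i)\<^sup>2 + (g
  i)\<^sup>2\<close>. For the inequality, the integral of the square of \<open>s * f + g\<close> is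
  a quadratic polynomial in \<open>s\<close> that is never negative; its value at the minimiser
  \<open>- B / A\<close> gives the claim.\<close>

lemma
  fixes f g :: "'a \<Rightarrow> real"
  assumes [measurable]: "f \<in> borel_measurable M" "g \<in> borel_measurable M"
    and f: "integrable M (\<lambda>i. (f i)\<^sup>2)" and g: "integrable M (\<lambda>i. (g i)\<^sup>2)"
  shows integrable_mult_L2: "integrable M (\<lambda>i. f i * g i)"
    and Cauchy_Schwarz_integral:
      "\<bar>\<integral>i. f i * g i \<partial>M\<bar> \<le> sqrt (\<integral>i. (f i)\<^sup>2 \<partial>M) * sqrt (\<integral>i. (g i)\<^sup>2 \<partial>M)"
proof -
  show fg: "integrable M (\<lambda>i. f i * g i)"
  proof (rule Bochner_Integration.integrable_bound[OF Bochner_Integration.integrable_add[OF f g]])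
    show "AE i in M. norm (f i * g i) \<le> norm ((f i)\<^sup>2 + (g i)\<^sup>2)"
    proof (rule AE_I2)
      fix i
      have "2 * (\<bar>f i\<bar> * \<bar>g i\<bar>) \<le> (f i)\<^sup>2 + (g i)\<^sup>2"
        using sum_squares_bound[of "\<bar>f i\<bar>" "\<bar>g i\<bar>"] by simp
      moreover have "0 \<le> \<bar>f i\<bar> * \<bar>g i\<bar>" by simp
      ultimately have "\<bar>f i\<bar> * \<bar>g i\<bar> \<le> (f i)\<^sup>2 + (g i)\<^sup>2" by linarith
      then show "norm (f i * g i) \<le> norm ((f i)\<^sup>2 + (g i)\<^sup>2)"
        by (simp add: abs_mult)
    qed
  qed simp
  define A B C where "A = (\<integral>i. (f i)\<^sup>2 \<partial>M)" and "B = (\<integral>i. f i * g i \<partial>M)"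
    and "C = (\<integral>i. (g i)\<^sup>2 \<partial>M)"
  have A: "A \<ge> 0" and C: "C \<ge> 0" by (auto simp: A_def C_def)
  have quad: "s\<^sup>2 * A + 2 * (s * B) + C \<ge> 0" for s
  proof -
    have "(\<integral>i. (s * f i + g i)\<^sup>2 \<partial>M)
        = (\<integral>i. s\<^sup>2 * (f i)\<^sup>2 + 2 * (s * (f i * g i)) + (g i)\<^sup>2 \<partial>M)"
      by (intro Bochner_Integration.integral_cong) (auto simp: power2_eq_square algebra_simps)
    also have "\<dots> = s\<^sup>2 * A + 2 * (s * B) + C"
      using f g fg by (simp add: A_def B_def C_def)
    finally show ?thesis
      by (metis (no_types, lifting) Bochner_Integration.integral_nonneg zero_le_power2)
  qed
  have "B\<^sup>2 \<le> A * C"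
  proof (cases "A = 0")
    case True
    have "B = 0"
    proof (rule ccontr)
      assume "B \<noteq> 0"
      \<comment> \<open>With \<open>A = 0\<close> the polynomial is affine, and this
        \<open>s\<close> gives it the value \<open>-1\<close>.\<close>
      with quad[of "- (C + 1) / (2 * B)"] True show False by (simp add: field_simps)
    qed
    with True show ?thesis by simp
  next
    case False
    with quad[of "- B / A"] A show ?thesis
      by (simp add: field_simps power2_eq_square)
  qed
  then have "sqrt (B\<^sup>2) \<le> sqrt (A * C)" by (rule real_sqrt_le_mono)
  then show "\<bar>\<integral>i. f i * g i \<partial>M\<bar> \<le> sqrt (\<integral>i. (f i)\<^sup>2 \<partial>M) * sqrt (\<integral>i. (g i)\<^sup>2 \<partial>M)"
    by (simp add: A_def B_def C_def real_sqrt_mult)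
qed

section \<open>Quadratic functionals along curves in the Hilbert space\<close>


lemma prob_space_I_leb: "prob_space I_leb"
  by (auto intro!: prob_spaceI simp: emeasure_restrict_space)

lemma L2_spaceD:
  assumes "u \<in> L2_space M"
  shows "u \<in> borel_measurable M" "integrable M (\<lambda>i. (norm (u i))\<^sup>2)"
  using assms by (auto simp: L2_space_def)

lemma L2_space_diff:
  assumes "u \<in> L2_space M" "w \<in> L2_space M"
  shows "(\<lambda>i. u i - w i) \<in> L2_space M"
proof -
  note [measurable] = L2_spaceD(1)[OF assms(1)] L2_spaceD(1)[OF assms(2)]
  have "integrable M (\<lambda>i. (norm (u i - w i))\<^sup>2)"
  proof (rule Bochner_Integration.integrable_bound)
    show "integrable M (\<lambda>i. 2 * (norm (u i))\<^sup>2 + 2 * (norm (w i))\<^sup>2)"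
      using L2_spaceD(2)[OF assms(1)] L2_spaceD(2)[OF assms(2)] by simp
    show "AE i in M. norm ((norm (u i - w i))\<^sup>2) \<le> norm (2 * (norm (u i))\<^sup>2 + 2 * (norm (w i))\<^sup>2)"
    proof (rule AE_I2)
      fix i
      have "(norm (u i - w i))\<^sup>2 \<le> (norm (u i) + norm (w i))\<^sup>2"
        by (intro power_mono norm_triangle_ineq4) auto
      also have "\<dots> \<le> 2 * (norm (u i))\<^sup>2 + 2 * (norm (w i))\<^sup>2"
        using sum_squares_bound[of "norm (u i)" "norm (w i)"] by (simp add: power2_sum)
      finally show "norm ((norm (u i - w i))\<^sup>2) \<le> norm (2 * (norm (u i))\<^sup>2 + 2 * (norm (w i))\<^sup>2)"
        by simp
    qed
  qed simp
  then show ?thesis by (simp add: L2_space_def)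
qed

lemma L2_space_scaleR:
  assumes "u \<in> L2_space M"
  shows "(\<lambda>i. c *\<^sub>R u i) \<in> L2_space M"
  using assms by (auto simp: L2_space_def power_mult_distrib)

lemma L2_norm_power2: "(L2_norm M u)\<^sup>2 = (\<integral>i. (norm (u i))\<^sup>2 \<partial>M)"
  by (simp add: L2_norm_def)

lemma L2_norm_nonneg: "0 \<le> L2_norm M u"
  by (simp add: L2_norm_def)

lemma
  assumes u: "u \<in> L2_space M" and w: "w \<in> L2_space M"
  shows integrable_norm_mult_L2: "integrable M (\<lambda>i. norm (u i) * norm (w i))"
    and integral_norm_mult_le: "(\<integral>i. norm (u i) * norm (w i) \<partial>M) \<le> L2_norm M u * L2_norm M w"
proof -
  note [measurable] = L2_spaceD(1)[OF u] L2_spaceD(1)[OF w]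
  show "integrable M (\<lambda>i. norm (u i) * norm (w i))"
    using L2_spaceD[OF u] L2_spaceD[OF w] by (intro integrable_mult_L2) auto
  show "(\<integral>i. norm (u i) * norm (w i) \<partial>M) \<le> L2_norm M u * L2_norm M w"
    using Cauchy_Schwarz_integral[of "\<lambda>i. norm (u i)" M "\<lambda>i. norm (w i)"]
      L2_spaceD[OF u] L2_spaceD[OF w]
    by (auto simp: L2_norm_def)
qed

lemma Lip_loc_L2E:
  assumes "x \<in> Lip_loc_L2" "0 \<le> t"
  obtains \<delta> L where "\<delta> > 0" "L \<ge> 0"
    "\<And>r s. r \<in> cball t \<delta> \<inter> {0..} \<Longrightarrow> s \<in> cball t \<delta> \<inter> {0..} \<Longrightarrow>
      L2_norm I_leb (\<lambda>i. x r i - x s i) \<le> L * dist r s"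
proof -
  from assms have "\<exists>u>0. \<exists>L\<ge>0. \<forall>r\<in>cball t u \<inter> {0..}. \<forall>s\<in>cball t u \<inter> {0..}.
      L2_norm I_leb (\<lambda>i. x r i - x s i) \<le> L * dist r s"
    unfolding Lip_loc_L2_def mem_Collect_eq by (elim conjE allE[of _ t] impE)
  then show thesis using that by metis
qed

lemma Lip_loc_L2_space: "x \<in> Lip_loc_L2 \<Longrightarrow> 0 \<le> t \<Longrightarrow> x t \<in> L2_space I_leb"
  by (simp add: Lip_loc_L2_def)

text \<open>\<open>\<gamma>\<close> plays the role of the gradient of \<open>g\<close>. A Taylor
  remainder that is uniformly quadratic, together with linear growth of \<open>\<gamma>\<close>,
  makes the weighted integral of \<open>g\<close> locally Lipschitz along curves in
  \<open>Lip_loc_L2\<close> and differentiable wherever the curve is. The instances below are the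
  squared distance to a half-space and the weighted squared distance to a point.\<close>

locale quadratic_functional =
  fixes \<theta> :: "real \<Rightarrow> real" and g :: "'b::euclidean_space \<Rightarrow> real" and \<gamma> :: "'b \<Rightarrow> 'b"
    and C :: real
  assumes theta_meas [measurable]: "\<theta> \<in> borel_measurable I_leb"
    and theta_range: "0 \<le> \<theta> i" "\<theta> i \<le> 1"
    and g_meas [measurable]: "g \<in> borel_measurable borel"
    and grad_meas [measurable]: "\<gamma> \<in> borel_measurable borel"
    and taylor: "\<bar>g y - g z - \<gamma> z \<bullet> (y - z)\<bar> \<le> (norm (y - z))\<^sup>2"
    and grad_bound: "norm (\<gamma> z) \<le> 2 * norm z + C"
begin

definition functional :: "(real \<Rightarrow> 'b) \<Rightarrow> real" where
  "functional u = (\<integral>i. \<theta> i * g (u i) \<partial>I_leb)"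

definition differential :: "(real \<Rightarrow> 'b) \<Rightarrow> (real \<Rightarrow> 'b) \<Rightarrow> real" where
  "differential u w = (\<integral>i. \<theta> i * (\<gamma> (u i) \<bullet> w i) \<partial>I_leb)"

interpretation prob_space I_leb by (rule prob_space_I_leb)

lemma C_nonneg: "0 \<le> C"
  using order_trans[OF norm_ge_zero grad_bound[of 0]] by simp

lemma grad_power2_bound: "(norm (\<gamma> z))\<^sup>2 \<le> 8 * (norm z)\<^sup>2 + 2 * C\<^sup>2"
proof -
  have "(norm (\<gamma> z))\<^sup>2 \<le> (2 * norm z + C)\<^sup>2"
    by (intro power_mono grad_bound) auto
  also have "\<dots> \<le> 8 * (norm z)\<^sup>2 + 2 * C\<^sup>2"
    using sum_squares_bound[of "2 * norm z" C] by (simp add: power2_sum power_mult_distrib)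
  finally show ?thesis .
qed

lemma grad_L2:
  assumes u: "u \<in> L2_space I_leb"
  shows "(\<lambda>i. \<gamma> (u i)) \<in> L2_space I_leb"
proof -
  note [measurable] = L2_spaceD(1)[OF u]
  have "integrable I_leb (\<lambda>i. (norm (\<gamma> (u i)))\<^sup>2)"
  proof (rule Bochner_Integration.integrable_bound)
    show "integrable I_leb (\<lambda>i. 8 * (norm (u i))\<^sup>2 + 2 * C\<^sup>2)"
      using L2_spaceD[OF u] by simp
  qed (use grad_power2_bound in auto)
  then show ?thesis by (simp add: L2_space_def)
qed

text \<open>The Taylor bound at the base point \<open>0\<close> shows that \<open>g\<close> grows at
  most quadratically, and the weight takes values in the unit interval.\<close>

lemma integrable_functional:
  assumes u: "u \<in> L2_space I_leb"
  shows "integrable I_leb (\<lambda>i. \<theta> i * g (u i))"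
proof (rule Bochner_Integration.integrable_bound)
  show "(\<lambda>i. \<theta> i * g (u i)) \<in> borel_measurable I_leb"
    using L2_spaceD(1)[OF u] by measurable
  show "integrable I_leb (\<lambda>i. \<bar>g 0\<bar> + C + (C + 1) * (norm (u i))\<^sup>2)"
    using L2_spaceD[OF u] by simp
  show "AE i in I_leb. norm (\<theta> i * g (u i)) \<le> norm (\<bar>g 0\<bar> + C + (C + 1) * (norm (u i))\<^sup>2)"
  proof (rule AE_I2)
    fix i
    have "\<bar>g (u i)\<bar> \<le> \<bar>g 0\<bar> + \<bar>\<gamma> 0 \<bullet> u i\<bar> + (norm (u i))\<^sup>2"
      using taylor[of "u i" 0] by simp
    also have "\<bar>\<gamma> 0 \<bullet> u i\<bar> \<le> C * norm (u i)"
    proof -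
      have "norm (\<gamma> 0) * norm (u i) \<le> C * norm (u i)"
        using grad_bound[of 0] by (intro mult_right_mono) auto
      then show ?thesis using Cauchy_Schwarz_ineq2[of "\<gamma> 0" "u i"] by linarith
    qed
    also have "C * norm (u i) \<le> C * (1 + (norm (u i))\<^sup>2)"
    proof (rule mult_left_mono[OF _ C_nonneg])
      show "norm (u i) \<le> 1 + (norm (u i))\<^sup>2"
        using sum_squares_bound[of 1 "norm (u i)"] norm_ge_zero[of "u i"]
        unfolding power_one mult_1_right by linarith
    qed
    finally have "\<bar>g (u i)\<bar> \<le> \<bar>g 0\<bar> + C + (C + 1) * (norm (u i))\<^sup>2"
      by (simp add: algebra_simps)
    moreover have "\<bar>\<theta> i * g (u i)\<bar> \<le> \<bar>g (u i)\<bar>"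
      using theta_range[of i] by (simp add: abs_mult mult_left_le_one_le)
    ultimately show "norm (\<theta> i * g (u i)) \<le> norm (\<bar>g 0\<bar> + C + (C + 1) * (norm (u i))\<^sup>2)"
      by simp
  qed
qed

lemma
  assumes u: "u \<in> L2_space I_leb" and w: "w \<in> L2_space I_leb"
  shows integrable_differential: "integrable I_leb (\<lambda>i. \<theta> i * (\<gamma> (u i) \<bullet> w i))"
    and differential_bound:
      "\<bar>differential u w\<bar> \<le> L2_norm I_leb (\<lambda>i. \<gamma> (u i)) * L2_norm I_leb w"
proof -
  note [measurable] = L2_spaceD(1)[OF u] L2_spaceD(1)[OF w]
  note gu = grad_L2[OF u]
  have le: "\<bar>\<theta> i * (\<gamma> (u i) \<bullet> w i)\<bar> \<le> norm (\<gamma> (u i)) * norm (w i)" for i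
  proof -
    have "\<bar>\<theta> i * (\<gamma> (u i) \<bullet> w i)\<bar> \<le> \<bar>\<gamma> (u i) \<bullet> w i\<bar>"
      using theta_range[of i] by (simp add: abs_mult mult_left_le_one_le)
    also have "\<dots> \<le> norm (\<gamma> (u i)) * norm (w i)" by (rule Cauchy_Schwarz_ineq2)
    finally show ?thesis .
  qed
  show int: "integrable I_leb (\<lambda>i. \<theta> i * (\<gamma> (u i) \<bullet> w i))"
    by (rule Bochner_Integration.integrable_bound[OF integrable_norm_mult_L2[OF gu w]])
      (use le in \<open>auto simp: abs_mult\<close>)
  have "\<bar>differential u w\<bar> \<le> (\<integral>i. \<bar>\<theta> i * (\<gamma> (u i) \<bullet> w i)\<bar> \<partial>I_leb)"
    unfolding differential_def using integral_norm_bound[of I_leb "\<lambda>i. \<theta> i * (\<gamma> (u i) \<bullet> w i)"] by simp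
  also have "\<dots> \<le> (\<integral>i. norm (\<gamma> (u i)) * norm (w i) \<partial>I_leb)"
    using int integrable_norm_mult_L2[OF gu w] le by (intro integral_mono) auto
  also have "\<dots> \<le> L2_norm I_leb (\<lambda>i. \<gamma> (u i)) * L2_norm I_leb w"
    by (rule integral_norm_mult_le[OF gu w])
  finally show "\<bar>differential u w\<bar> \<le> L2_norm I_leb (\<lambda>i. \<gamma> (u i)) * L2_norm I_leb w" .
qed

lemma functional_taylor:
  assumes u: "u \<in> L2_space I_leb" and w: "w \<in> L2_space I_leb"
  shows "\<bar>functional u - functional w - differential w (\<lambda>i. u i - w i)\<bar>
    \<le> (L2_norm I_leb (\<lambda>i. u i - w i))\<^sup>2"
proof -
  let ?f = "\<lambda>i. \<theta> i * (g (u i) - g (w i) - \<gamma> (w i) \<bullet> (u i - w i))"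
  note d = L2_space_diff[OF u w]
  note ints = integrable_functional[OF u] integrable_functional[OF w] integrable_differential[OF w d]
  have f_eq: "?f = (\<lambda>i. \<theta> i * g (u i) - \<theta> i * g (w i) - \<theta> i * (\<gamma> (w i) \<bullet> (u i - w i)))"
    by (auto simp: algebra_simps)
  have int: "integrable I_leb ?f"
    unfolding f_eq using ints by (intro Bochner_Integration.integrable_diff)
  have "functional u - functional w - differential w (\<lambda>i. u i - w i) = (\<integral>i. ?f i \<partial>I_leb)"
    unfolding functional_def differential_def f_eq using ints
    by (simp only: Bochner_Integration.integral_diff Bochner_Integration.integrable_diff)
  also have "\<bar>\<dots>\<bar> \<le> (\<integral>i. \<bar>?f i\<bar> \<partial>I_leb)"
    using integral_norm_bound[of I_leb ?f] by simp
  also have "\<dots> \<le> (\<integral>i. (norm (u i - w i))\<^sup>2 \<partial>I_leb)"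
  proof (intro integral_mono)
    fix i
    have "\<bar>?f i\<bar> \<le> \<bar>g (u i) - g (w i) - \<gamma> (w i) \<bullet> (u i - w i)\<bar>"
      using theta_range[of i] by (simp add: abs_mult mult_left_le_one_le)
    also have "\<dots> \<le> (norm (u i - w i))\<^sup>2" by (rule taylor)
    finally show "\<bar>?f i\<bar> \<le> (norm (u i - w i))\<^sup>2" .
  qed (use int L2_spaceD[OF d] in auto)
  finally show ?thesis by (simp add: L2_norm_power2)
qed

text \<open>Comparison with a reference point \<open>w\<close> makes the bound uniform for all
  \<open>u\<close> in a ball around \<open>w\<close>; this is what local Lipschitz continuity
  requires.\<close>

lemma grad_L2_norm_bound:
  assumes u: "u \<in> L2_space I_leb" and w: "w \<in> L2_space I_leb"
  shows "(L2_norm I_leb (\<lambda>i. \<gamma> (u i)))\<^sup>2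
    \<le> 16 * (L2_norm I_leb (\<lambda>i. u i - w i))\<^sup>2 + 16 * (L2_norm I_leb w)\<^sup>2 + 2 * C\<^sup>2"
proof -
  note d = L2_space_diff[OF u w]
  have "(\<integral>i. (norm (\<gamma> (u i)))\<^sup>2 \<partial>I_leb)
      \<le> (\<integral>i. 16 * (norm (u i - w i))\<^sup>2 + 16 * (norm (w i))\<^sup>2 + 2 * C\<^sup>2 \<partial>I_leb)"
  proof (intro integral_mono)
    fix i
    have "(norm (u i))\<^sup>2 \<le> (norm (u i - w i) + norm (w i))\<^sup>2"
      using norm_triangle_ineq[of "u i - w i" "w i"] by (intro power_mono) auto
    also have "\<dots> \<le> 2 * (norm (u i - w i))\<^sup>2 + 2 * (norm (w i))\<^sup>2"
      using sum_squares_bound[of "norm (u i - w i)" "norm (w i)"] by (simp add: power2_sum)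
    finally show "(norm (\<gamma> (u i)))\<^sup>2 \<le> 16 * (norm (u i - w i))\<^sup>2 + 16 * (norm (w i))\<^sup>2 + 2 * C\<^sup>2"
      using grad_power2_bound[of "u i"] by linarith
  qed (use L2_spaceD[OF grad_L2[OF u]] L2_spaceD[OF d] L2_spaceD[OF w] in auto)
  also have "\<dots> = 16 * (L2_norm I_leb (\<lambda>i. u i - w i))\<^sup>2 + 16 * (L2_norm I_leb w)\<^sup>2 + 2 * C\<^sup>2"
    using L2_spaceD[OF d] L2_spaceD[OF w] prob_space by (simp add: L2_norm_power2)
  finally show ?thesis by (simp add: L2_norm_power2)
qed

text \<open>The differential contributes a term linear in the increment of the curve, and the
  quadratic remainder is absorbed because increments are bounded on a small ball. The one-point
  parameter set casts the claim in the form from which a uniform constant on compact intervals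
  follows.\<close>

lemma functional_locally_lipschitz:
  assumes x: "x \<in> Lip_loc_L2"
  shows "local_lipschitz {0::real} {0..} (\<lambda>_ t. functional (x t))"
proof (rule local_lipschitzI)
  fix z t :: real assume "t \<in> {0..}"
  then have t: "0 \<le> t" by simp
  have L2: "x s \<in> L2_space I_leb" if "0 \<le> s" for s
    using Lip_loc_L2_space[OF x that] .
  obtain \<delta> L where \<delta>: "\<delta> > 0" "L \<ge> 0"
    and L: "\<And>r s. r \<in> cball t \<delta> \<inter> {0..} \<Longrightarrow> s \<in> cball t \<delta> \<inter> {0..} \<Longrightarrow>
        L2_norm I_leb (\<lambda>i. x r i - x s i) \<le> L * dist r s"
    by (rule Lip_loc_L2E[OF x t]) blast
  \<comment> \<open>\<open>B\<close> bounds the norm of the gradient along the whole curve inside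
    the ball around \<open>t\<close>; \<open>L * \<delta>\<close> is the largest distance from
    \<open>x t\<close> there.\<close>
  define B where "B = sqrt (16 * (L * \<delta>)\<^sup>2 + 16 * (L2_norm I_leb (x t))\<^sup>2 + 2 * C\<^sup>2)"
  have B: "L2_norm I_leb (\<lambda>i. \<gamma> (x s i)) \<le> B" if s: "s \<in> cball t \<delta> \<inter> {0..}" for s
    unfolding B_def
  proof (rule real_le_rsqrt)
    have "L2_norm I_leb (\<lambda>i. x s i - x t i) \<le> L * dist s t"
      using s t \<delta> by (intro L) auto
    also have "\<dots> \<le> L * \<delta>"
      using s \<delta> by (intro mult_left_mono) (auto simp: dist_commute)
    finally have "(L2_norm I_leb (\<lambda>i. x s i - x t i))\<^sup>2 \<le> (L * \<delta>)\<^sup>2"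
      by (intro power_mono L2_norm_nonneg)
    with grad_L2_norm_bound[OF L2[of s] L2[OF t]] s
    show "(L2_norm I_leb (\<lambda>i. \<gamma> (x s i)))\<^sup>2 \<le> 16 * (L * \<delta>)\<^sup>2 + 16 * (L2_norm I_leb (x t))\<^sup>2 + 2 * C\<^sup>2"
      by simp
  qed
  have "B \<ge> 0"
    by (simp add: B_def)
  have "(B * L + L * L * (2 * \<delta>))-lipschitz_on (cball t \<delta> \<inter> {0..}) (\<lambda>t. functional (x t))"
  proof (rule lipschitz_onI)
    fix r s assume rs: "r \<in> cball t \<delta> \<inter> {0..}" "s \<in> cball t \<delta> \<inter> {0..}"
    define n where "n = L2_norm I_leb (\<lambda>i. x r i - x s i)"
    have n: "0 \<le> n" "n \<le> L * dist r s"
      using L[OF rs] by (auto simp: n_def L2_norm_nonneg)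
    have "dist r s \<le> 2 * \<delta>"
      using rs by (auto simp: dist_real_def)
    have xr: "x r \<in> L2_space I_leb" and xs: "x s \<in> L2_space I_leb"
      using rs by (auto intro: L2)
    have "\<bar>functional (x r) - functional (x s)\<bar> \<le> \<bar>differential (x s) (\<lambda>i. x r i - x s i)\<bar> + n\<^sup>2"
      using functional_taylor[OF xr xs] by (simp add: n_def)
    also have "\<bar>differential (x s) (\<lambda>i. x r i - x s i)\<bar> \<le> L2_norm I_leb (\<lambda>i. \<gamma> (x s i)) * n"
      using differential_bound[OF xs L2_space_diff[OF xr xs]] by (simp add: n_def)
    also have "\<dots> \<le> B * (L * dist r s)"
      using B[OF rs(2)] n \<open>B \<ge> 0\<close> by (intro mult_mono) (auto simp: L2_norm_nonneg)
    also have "n\<^sup>2 \<le> (L * dist r s) * (L * (2 * \<delta>))"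
    proof -
      have "n * n \<le> (L * dist r s) * (L * dist r s)"
        using n \<delta> by (intro mult_mono) auto
      also have "\<dots> \<le> (L * dist r s) * (L * (2 * \<delta>))"
        using \<open>dist r s \<le> 2 * \<delta>\<close> \<delta> by (intro mult_left_mono) auto
      finally show ?thesis by (simp add: power2_eq_square)
    qed
    finally show "dist (functional (x r)) (functional (x s)) \<le> (B * L + L * L * (2 * \<delta>)) * dist r s"
      by (simp add: dist_real_def algebra_simps)
  qed (use \<open>B \<ge> 0\<close> \<delta> in auto)
  then show "\<exists>u>0. \<exists>L. \<forall>t'\<in>cball z u \<inter> {0}. L-lipschitz_on (cball t u \<inter> {0..}) (\<lambda>t. functional (x t))"
    using \<delta>(1) by (intro exI[of _ \<delta>] conjI exI ballI) auto
qed

text \<open>The error of the difference quotient splits into the Taylor remainder divided by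
  \<open>s - t\<close>, which the Lipschitz property makes of order
  \<open>\<bar>s - t\<bar>\<close>, and the differential applied to the error of the quotient of the
  curve, which tends to zero by Cauchy-Schwarz.\<close>

lemma functional_has_derivative:
  assumes x: "x \<in> Lip_loc_L2" and t: "0 \<le> t" and v: "has_L2_time_derivative x v t"
  shows "((\<lambda>s. functional (x s)) has_real_derivative differential (x t) v) (at t within {0..})"
proof -
  have L2: "x s \<in> L2_space I_leb" if "0 \<le> s" for s
    using Lip_loc_L2_space[OF x that] .
  have v2: "v \<in> L2_space I_leb"
    and v_lim: "((\<lambda>s. L2_norm I_leb (\<lambda>i. (x s i - x t i) /\<^sub>R (s - t) - v i)) \<longlongrightarrow> 0) (at t within {0..})"
    using v by (auto simp: has_L2_time_derivative_def)
  obtain \<delta> L where \<delta>: "\<delta> > 0" "L \<ge> 0"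
    and L: "\<And>r s. r \<in> cball t \<delta> \<inter> {0..} \<Longrightarrow> s \<in> cball t \<delta> \<inter> {0..} \<Longrightarrow>
        L2_norm I_leb (\<lambda>i. x r i - x s i) \<le> L * dist r s"
    by (rule Lip_loc_L2E[OF x t]) blast
  let ?q = "\<lambda>s. (functional (x s) - functional (x t)) / (s - t)"
  let ?e = "\<lambda>s. L2_norm I_leb (\<lambda>i. (x s i - x t i) /\<^sub>R (s - t) - v i)"
  let ?G = "L2_norm I_leb (\<lambda>i. \<gamma> (x t i))"
  have bound: "\<bar>?q s - differential (x t) v\<bar> \<le> L\<^sup>2 * \<bar>s - t\<bar> + ?G * ?e s"
    if s: "s \<in> cball t \<delta> \<inter> {0..}" "s \<noteq> t" for s
  proof -
    have xs: "x s \<in> L2_space I_leb" and xt: "x t \<in> L2_space I_leb"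
      using s t by (auto intro: L2)
    note d = L2_space_diff[OF xs xt]
    define w where "w i = x s i - x t i" for i
    have w: "w \<in> L2_space I_leb"
      using d unfolding w_def .
    have qw: "(\<lambda>i. w i /\<^sub>R (s - t)) \<in> L2_space I_leb"
      by (rule L2_space_scaleR[OF w])
    have "differential (x t) (\<lambda>i. w i /\<^sub>R (s - t) - v i)
      = (\<integral>i. (\<theta> i * (\<gamma> (x t i) \<bullet> w i)) / (s - t) - \<theta> i * (\<gamma> (x t i) \<bullet> v i) \<partial>I_leb)"
      unfolding differential_def
      by (intro Bochner_Integration.integral_cong) (simp_all add: inner_diff_right right_diff_distrib divide_inverse mult_ac)
    also have "\<dots> = differential (x t) w / (s - t) - differential (x t) v"
      unfolding differential_def
      using integrable_differential[OF xt w] integrable_differential[OF xt v2] by simp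
    finally have lin: "differential (x t) (\<lambda>i. w i /\<^sub>R (s - t) - v i)
        = differential (x t) w / (s - t) - differential (x t) v" .
    have split: "?q s - differential (x t) v
        = (functional (x s) - functional (x t) - differential (x t) w) / (s - t)
          + differential (x t) (\<lambda>i. w i /\<^sub>R (s - t) - v i)"
      unfolding lin by (simp add: diff_divide_distrib)
    have remainder: "\<bar>(functional (x s) - functional (x t) - differential (x t) w) / (s - t)\<bar>
        \<le> L\<^sup>2 * \<bar>s - t\<bar>"
    proof -
      have "L2_norm I_leb w \<le> L * \<bar>s - t\<bar>"
        using L[of s t] s t \<delta> unfolding w_def[abs_def] by (simp add: dist_real_def)
      then have "(L2_norm I_leb w)\<^sup>2 \<le> (L * \<bar>s - t\<bar>)\<^sup>2"
        by (intro power_mono L2_norm_nonneg)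
      moreover have "\<bar>functional (x s) - functional (x t) - differential (x t) w\<bar> \<le> (L2_norm I_leb w)\<^sup>2"
        using functional_taylor[OF xs xt] unfolding w_def[abs_def] .
      ultimately have "\<bar>functional (x s) - functional (x t) - differential (x t) w\<bar>
          \<le> (L * \<bar>s - t\<bar>)\<^sup>2"
        by linarith
      also have "\<dots> = L\<^sup>2 * \<bar>s - t\<bar> * \<bar>s - t\<bar>"
        by (simp only: power2_eq_square mult_ac)
      finally show ?thesis
        unfolding abs_divide using s by (subst pos_divide_le_eq) auto
    qed
    have "\<bar>differential (x t) (\<lambda>i. w i /\<^sub>R (s - t) - v i)\<bar> \<le> ?G * ?e s"
      using differential_bound[OF xt L2_space_diff[OF qw v2]] unfolding w_def .
    with remainder show ?thesis
      unfolding split using abs_triangle_ineq order_trans add_mono by meson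
  qed
  have "((\<lambda>s. ?q s - differential (x t) v) \<longlongrightarrow> 0) (at t within {0..})"
  proof (rule Lim_null_comparison)
    have "((\<lambda>s. s) \<longlongrightarrow> t) (at t within {0..})" by (rule tendsto_ident_at)
    then have "((\<lambda>s. L\<^sup>2 * \<bar>s - t\<bar> + ?G * ?e s) \<longlongrightarrow> L\<^sup>2 * \<bar>t - t\<bar> + ?G * 0) (at t within {0..})"
      using v_lim by (intro tendsto_intros)
    then show "((\<lambda>s. L\<^sup>2 * \<bar>s - t\<bar> + ?G * ?e s) \<longlongrightarrow> 0) (at t within {0..})" by simp
    show "\<forall>\<^sub>F s in at t within {0..}. norm (?q s - differential (x t) v) \<le> L\<^sup>2 * \<bar>s - t\<bar> + ?G * ?e s"
      unfolding eventually_at real_norm_def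
    proof (intro exI[of _ \<delta>] conjI ballI impI)
      fix s assume "s \<in> {0..}" "s \<noteq> t \<and> dist s t < \<delta>"
      then show "\<bar>?q s - differential (x t) v\<bar> \<le> L\<^sup>2 * \<bar>s - t\<bar> + ?G * ?e s"
        by (intro bound) (auto simp: dist_commute)
    qed (rule \<delta>)
  qed
  then show ?thesis
    by (simp add: has_field_derivative_iff LIM_zero_iff)
qed

lemma functional_continuous:
  assumes x: "x \<in> Lip_loc_L2" and "0 \<le> a"
  shows "continuous_on {a..b} (\<lambda>t. functional (x t))"
  using local_lipschitz_continuous_on[OF functional_locally_lipschitz[OF x], of 0] \<open>0 \<le> a\<close>
  by (auto elim: continuous_on_subset)

lemma energy_inequality:
  assumes x: "x \<in> Lip_loc_L2" and ab: "0 \<le> a" "a \<le> b"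
    and r: "integrable (lebesgue_on {a..b}) r"
    and v: "AE t in lebesgue_on {a..b}. \<exists>v. has_L2_time_derivative x v t \<and> differential (x t) v \<le> r t"
  shows "functional (x b) - functional (x a) \<le> (\<integral>t. r t \<partial>lebesgue_on {a..b})"
proof -
  \<comment> \<open>The interval is prolonged to \<open>b + 1\<close> to leave room for forward
    difference quotients at \<open>b\<close>.\<close>
  have lip: "local_lipschitz {0::real} {a..b + 1} (\<lambda>_ t. functional (x t))"
    by (rule local_lipschitz_subset[OF functional_locally_lipschitz[OF x]]) (use ab in auto)
  obtain L where L: "L-lipschitz_on {a..b + 1} (\<lambda>t. functional (x t))"
    by (rule local_lipschitz_compact_implies_lipschitz[OF lip]) auto
  have "AE t in lebesgue_on {a..b}. t \<in> {a..b}"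
    by (auto intro: AE_I2)
  with v have "AE t in lebesgue_on {a..b}. \<exists>D. ((\<lambda>t. functional (x t)) has_real_derivative D)
      (at t within {a..b + 1}) \<and> D \<le> r t"
  proof eventually_elim
    case (elim t)
    then obtain v where v: "has_L2_time_derivative x v t" "differential (x t) v \<le> r t" by (elim exE conjE)
    have "((\<lambda>s. functional (x s)) has_real_derivative differential (x t) v) (at t within {a..b + 1})"
      by (rule has_field_derivative_subset[OF functional_has_derivative[OF x _ v(1)]])
        (use elim ab in auto)
    with v show ?case by blast
  qed
  with ab L r show ?thesis
    by (intro lipschitz_integral_bound[of a b "b + 1" L]) auto
qed

end

section \<open>Maximum principle\<close>


text \<open>With \<open>H\<close> the primitive of \<open>G\<close> vanishing at \<open>0\<close>,
  the product \<open>exp (- K * t) * H t\<close> has nonpositive derivative. Hence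
  \<open>H T \<le> 0\<close>, and the integral inequality forces \<open>G T \<le> 0\<close>.\<close>

lemma gronwall_zero:
  fixes G :: "real \<Rightarrow> real"
  assumes cont: "continuous_on {0..T} G" and K: "0 \<le> K" and T: "0 \<le> T"
    and nonneg: "\<And>t. t \<in> {0..T} \<Longrightarrow> 0 \<le> G t"
    and le: "\<And>t. t \<in> {0..T} \<Longrightarrow> G t \<le> K * integral {0..t} G"
  shows "G T = 0"
proof -
  define H where "H t = integral {0..t} G" for t
  have H: "(H has_real_derivative G t) (at t within {0..T})" if "t \<in> {0..T}" for t
    unfolding H_def[abs_def] using integral_has_real_derivative[OF cont that] .
  have H_cont: "continuous_on {0..T} H"
    using H DERIV_continuous_on by blast
  have "exp (- K * T) * H T \<le> exp (- K * 0) * H 0"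
  proof (rule DERIV_nonpos_imp_decreasing_open[OF T])
    fix t assume t: "0 < t" "t < T"
    then have "(H has_real_derivative G t) (at t)"
      using H[of t] at_within_Icc_at[of 0 t T] by simp
    then have "((\<lambda>t. exp (- K * t) * H t) has_real_derivative
        exp (- K * t) * (G t - K * H t)) (at t)"
      by (auto intro!: derivative_eq_intros simp: algebra_simps)
    moreover have "exp (- K * t) * (G t - K * H t) \<le> 0"
      using le[of t] t by (intro mult_nonneg_nonpos) (auto simp: H_def)
    ultimately show "\<exists>y. ((\<lambda>t. exp (- K * t) * H t) has_real_derivative y) (at t) \<and> y \<le> 0"
      by blast
  qed (intro continuous_intros H_cont)
  then have "H T \<le> 0"
    by (simp add: H_def mult_le_0_iff)
  then have "G T \<le> 0"
    using le[of T] T K mult_nonneg_nonpos[of K "H T"] by (simp add: H_def)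
  with nonneg[of T] T show ?thesis by simp
qed

lemma AE_lebesgue_on_subset:
  assumes "AE t in lebesgue_on S. P t" "T \<subseteq> S" "S \<in> sets lebesgue" "T \<in> sets lebesgue"
  shows "AE t in lebesgue_on T. P t"
proof -
  have "AE t in lebesgue. t \<in> S \<longrightarrow> P t"
    using assms(1,3) by (subst (asm) AE_restrict_space_iff) auto
  then have "AE t in lebesgue. t \<in> T \<longrightarrow> P t"
    using assms(2) by (auto elim!: eventually_mono)
  then show ?thesis
    using assms(4) by (subst AE_restrict_space_iff) auto
qed

text \<open>The square of the positive part is continuously differentiable with a derivative of
  Lipschitz constant 2, which explains the coefficient one of the remainder. The proof goes through
  the signs of \<open>p\<close> and \<open>p + k\<close>.\<close>

lemma positive_part_square_taylor:
  fixes p k :: real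
  shows "\<bar>(max 0 (p + k))\<^sup>2 - (max 0 p)\<^sup>2 - 2 * max 0 p * k\<bar> \<le> k\<^sup>2"
proof -
  consider "0 \<le> p" "0 \<le> p + k" | "0 \<le> p" "p + k < 0" | "p < 0" "0 \<le> p + k" | "p < 0" "p + k < 0"
    by linarith
  then show ?thesis
  proof cases
    case 1
    then show ?thesis by (simp add: power2_eq_square algebra_simps)
  next
    case 2
    \<comment> \<open>This makes the remaining expression nonnegative, while its upper bound is the
      expanded inequality \<open>0 \<le> (p + k)\<^sup>2\<close>.\<close>
    have "0 \<le> p * (- 2 * k - p)" using 2 by (intro mult_nonneg_nonneg) auto
    moreover have "0 \<le> (p + k)\<^sup>2" by simp
    ultimately have "\<bar>- p\<^sup>2 - 2 * p * k\<bar> \<le> k\<^sup>2"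
      by (simp add: power2_eq_square algebra_simps)
    with 2 show ?thesis by simp
  next
    case 3
    then have "(p + k)\<^sup>2 \<le> k\<^sup>2" by (intro power_mono) auto
    with 3 show ?thesis by simp
  next
    case 4
    then show ?thesis by simp
  qed
qed

text \<open>For a unit vector \<open>e\<close>, the function
  \<open>max 0 (e \<bullet> z - R)\<close> is the distance to the half-space. Since
  \<open>0 \<le> R\<close>, it is at most \<open>norm z\<close>, so the gradient bound holds with
  offset \<open>0\<close>.\<close>

lemma half_space_quadratic_functional:
  fixes e :: "'b::euclidean_space"
  assumes e: "norm e = 1" and R: "0 \<le> R"
  shows "quadratic_functional (\<lambda>_. 1) (\<lambda>z. (max 0 (e \<bullet> z - R))\<^sup>2)
    (\<lambda>z. (2 * max 0 (e \<bullet> z - R)) *\<^sub>R e) 0"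
proof
  fix y z :: 'b
  have le: "(e \<bullet> (y - z))\<^sup>2 \<le> (norm (y - z))\<^sup>2"
    using Cauchy_Schwarz_ineq2[of e "y - z"] e by (simp add: abs_le_square_iff[symmetric])
  have eq: "e \<bullet> z - R + e \<bullet> (y - z) = e \<bullet> y - R"
    by (simp add: inner_diff_right)
  show "\<bar>(max 0 (e \<bullet> y - R))\<^sup>2 - (max 0 (e \<bullet> z - R))\<^sup>2
      - ((2 * max 0 (e \<bullet> z - R)) *\<^sub>R e) \<bullet> (y - z)\<bar> \<le> (norm (y - z))\<^sup>2"
    using positive_part_square_taylor[of "e \<bullet> z - R" "e \<bullet> (y - z)"] le
    unfolding eq inner_scaleR_left by linarith
  have "e \<bullet> z \<le> norm z"
    using norm_cauchy_schwarz[of e z] e by simp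
  with e R show "norm ((2 * max 0 (e \<bullet> z - R)) *\<^sub>R e) \<le> 2 * norm z + 0"
    by (auto simp: max_def)
qed simp_all

text \<open>Let \<open>p t i\<close> be the excess of \<open>x t i\<close> over the half-space and
  \<open>G t\<close> the integral of its square. Where the excess is positive, the term of
  \<open>j\<close> pushes outwards at rate at most \<open>\<Phi> * p t j\<close>. Hence
  \<open>G\<close> grows at rate at most \<open>2 * \<Phi> * G\<close>, and Gronwall with
  \<open>G 0 = 0\<close> makes the excess vanish almost everywhere.\<close>

lemma half_space_invariant:
  fixes x :: "real \<Rightarrow> real \<Rightarrow> 'b::euclidean_space"
  assumes sol: "graphon_solution a \<phi> x0 x"
    and a_range: "\<forall>t\<ge>0. \<forall>i\<in>{0..1}. \<forall>j\<in>{0..1}. a t i j \<in> {0..1}"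
    and phi: "\<And>r. 0 \<le> r \<Longrightarrow> 0 \<le> \<phi> r" "\<And>r. 0 \<le> r \<Longrightarrow> \<phi> r \<le> \<Phi>"
    and e: "norm e = 1" and R: "0 \<le> R" and init: "AE i in I_leb. e \<bullet> x0 i \<le> R"
    and T: "0 \<le> T"
  shows "AE i in I_leb. e \<bullet> x T i \<le> R"
proof -
  interpret Q: quadratic_functional "\<lambda>_. 1" "\<lambda>z. (max 0 (e \<bullet> z - R))\<^sup>2"
    "\<lambda>z. (2 * max 0 (e \<bullet> z - R)) *\<^sub>R e" 0
    by (rule half_space_quadratic_functional[OF e R])
  interpret prob_space I_leb by (rule prob_space_I_leb)
  have x: "x \<in> Lip_loc_L2" and x_init: "AE i in I_leb. x 0 i = x0 i"
    and deriv: "AE t in lebesgue_on {0..}. \<exists>v. has_L2_time_derivative x v t \<and>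
        (AE i in I_leb.
           integrable I_leb (\<lambda>j. (a t i j * \<phi> (norm (x t i - x t j))) *\<^sub>R (x t j - x t i)) \<and>
           v i = (\<integral>j. (a t i j * \<phi> (norm (x t i - x t j))) *\<^sub>R (x t j - x t i) \<partial>I_leb))"
    using sol by (auto simp: graphon_solution_def)
  have \<Phi>: "0 \<le> \<Phi>"
    using phi[of 0] by simp
  define p where "p t i = max 0 (e \<bullet> x t i - R)" for t i
  define G where "G t = Q.functional (x t)" for t
  have G_eq: "G t = (\<integral>i. (p t i)\<^sup>2 \<partial>I_leb)" for t
    by (simp add: G_def Q.functional_def p_def)
  have G_nonneg: "0 \<le> G t" for t
    by (simp add: G_eq)
  have p_meas [measurable]: "p t \<in> borel_measurable I_leb" if "0 \<le> t" for t
    unfolding p_def using L2_spaceD(1)[OF Lip_loc_L2_space[OF x that]] by measurable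
  have p2_int: "integrable I_leb (\<lambda>i. (p t i)\<^sup>2)" if "0 \<le> t" for t
    using Q.integrable_functional[OF Lip_loc_L2_space[OF x that]] by (simp add: p_def)
  have p_int: "integrable I_leb (p t)" if "0 \<le> t" for t
    using integrable_mult_L2[of "p t" I_leb "\<lambda>_. 1"] p_meas[OF that] p2_int[OF that] by simp
  \<comment> \<open>This is Cauchy-Schwarz against the constant one on a space of total mass
    one.\<close>
  have p_jensen: "(\<integral>i. p t i \<partial>I_leb)\<^sup>2 \<le> G t" if "0 \<le> t" for t
  proof -
    have "\<bar>\<integral>i. p t i \<partial>I_leb\<bar> \<le> sqrt (G t)"
      using Cauchy_Schwarz_integral[of "p t" I_leb "\<lambda>_. 1"] p_meas[OF that] p2_int[OF that] prob_space
      by (simp add: G_eq)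
    then have "\<bar>\<integral>i. p t i \<partial>I_leb\<bar>\<^sup>2 \<le> (sqrt (G t))\<^sup>2"
      by (intro power_mono) auto
    then show ?thesis
      using G_nonneg[of t] by simp
  qed
  have dissipation: "Q.differential (x t) v \<le> 2 * \<Phi> * G t"
    if t: "0 \<le> t" and v: "v \<in> L2_space I_leb"
      and v_eq: "AE i in I_leb.
           integrable I_leb (\<lambda>j. (a t i j * \<phi> (norm (x t i - x t j))) *\<^sub>R (x t j - x t i)) \<and>
           v i = (\<integral>j. (a t i j * \<phi> (norm (x t i - x t j))) *\<^sub>R (x t j - x t i) \<partial>I_leb)" for t v
  proof -
    let ?P = "\<integral>i. p t i \<partial>I_leb"
    have "Q.differential (x t) v \<le> (\<integral>i. 2 * \<Phi> * ?P * p t i \<partial>I_leb)"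
      unfolding Q.differential_def
    proof (rule integral_mono_AE)
      show "integrable I_leb (\<lambda>i. 1 * (((2 * max 0 (e \<bullet> x t i - R)) *\<^sub>R e) \<bullet> v i))"
        by (rule Q.integrable_differential[OF Lip_loc_L2_space[OF x t] v])
      show "integrable I_leb (\<lambda>i. 2 * \<Phi> * ?P * p t i)"
        using p_int[OF t] by simp
      have "AE i in I_leb. i \<in> {0..1}"
        by (rule AE_I2) simp
      with v_eq show "AE i in I_leb. 1 * (((2 * max 0 (e \<bullet> x t i - R)) *\<^sub>R e) \<bullet> v i) \<le> 2 * \<Phi> * ?P * p t i"
      proof eventually_elim
        case (elim i)
        let ?w = "\<lambda>j. a t i j * \<phi> (norm (x t i - x t j))"
        let ?f = "\<lambda>j. ?w j *\<^sub>R (x t j - x t i)"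
        have f: "integrable I_leb ?f" and vi: "v i = (\<integral>j. ?f j \<partial>I_leb)"
          using elim by auto
        have "p t i * (e \<bullet> v i) = (\<integral>j. p t i * (e \<bullet> ?f j) \<partial>I_leb)"
        proof -
          have "(\<integral>j. e \<bullet> ?f j \<partial>I_leb) = e \<bullet> (\<integral>j. ?f j \<partial>I_leb)"
            by (rule integral_inner_right) (rule f)
          then show ?thesis
            unfolding vi integral_mult_right_zero by simp
        qed
        also have "\<dots> \<le> (\<integral>j. p t i * (\<Phi> * p t j) \<partial>I_leb)"
        proof (intro integral_mono)
          show "integrable I_leb (\<lambda>j. p t i * (e \<bullet> ?f j))"
            by (intro integrable_mult_right integrable_inner_right f)
          show "integrable I_leb (\<lambda>j. p t i * (\<Phi> * p t j))"
            using p_int[OF t] by simp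
          fix j assume "j \<in> space I_leb"
          then have a: "0 \<le> a t i j" "a t i j \<le> 1"
            using a_range t elim by auto
          have w: "0 \<le> ?w j" "?w j \<le> \<Phi>"
            using a phi[of "norm (x t i - x t j)"] mult_mono[of "a t i j" 1 "\<phi> (norm (x t i - x t j))" \<Phi>]
            by auto
          \<comment> \<open>Inside the half-space \<open>p t i\<close> vanishes and both sides are
            zero. Outside, \<open>R < e \<bullet> x t i\<close>, so the difference of the
            projections is at most the excess of \<open>x t j\<close>.\<close>
          show "p t i * (e \<bullet> ?f j) \<le> p t i * (\<Phi> * p t j)"
          proof (cases "e \<bullet> x t i \<le> R")
            case False
            have "e \<bullet> ?f j = ?w j * (e \<bullet> x t j - e \<bullet> x t i)"
              by (simp add: inner_diff_right)
            also have "\<dots> \<le> ?w j * p t j"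
              using False w by (intro mult_left_mono) (auto simp: p_def)
            also have "\<dots> \<le> \<Phi> * p t j"
              using w by (intro mult_right_mono) (auto simp: p_def)
            finally show ?thesis
              by (intro mult_left_mono) (auto simp: p_def)
          qed (simp add: p_def)
        qed
        also have "\<dots> = \<Phi> * ?P * p t i"
          by simp
        finally show ?case
          by (simp add: p_def)
      qed
    qed
    also have "\<dots> = 2 * \<Phi> * ?P\<^sup>2"
      by (simp add: power2_eq_square)
    also have "\<dots> \<le> 2 * \<Phi> * G t"
      using p_jensen[OF t] \<Phi> by (intro mult_left_mono) auto
    finally show ?thesis .
  qed
  have G_cont: "continuous_on {0..t} G" for t
    unfolding G_def[abs_def] by (rule Q.functional_continuous[OF x]) simp
  have G_0: "G 0 = 0"
  proof -
    have "AE i in I_leb. (p 0 i)\<^sup>2 = 0"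
      using x_init init by eventually_elim (simp add: p_def)
    then show ?thesis
      unfolding G_eq by (rule integral_eq_zero_AE)
  qed
  have "G T = 0"
  proof (rule gronwall_zero[where K = "2 * \<Phi>" and T = T, OF G_cont _ T G_nonneg])
    fix t assume t: "t \<in> {0..T}"
    have int: "integrable (lebesgue_on {0..t}) (\<lambda>s. 2 * \<Phi> * G s)"
      using G_cont[of t] continuous_imp_integrable_real by auto
    have "AE s in lebesgue_on {0..t}. \<exists>v. has_L2_time_derivative x v s \<and>
        Q.differential (x s) v \<le> 2 * \<Phi> * G s"
    proof -
      have "AE s in lebesgue_on {0..t}. s \<in> {0..t}"
        by (rule AE_I2) simp
      moreover have "AE s in lebesgue_on {0..t}. \<exists>v. has_L2_time_derivative x v s \<and>
        (AE i in I_leb.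
           integrable I_leb (\<lambda>j. (a s i j * \<phi> (norm (x s i - x s j))) *\<^sub>R (x s j - x s i)) \<and>
           v i = (\<integral>j. (a s i j * \<phi> (norm (x s i - x s j))) *\<^sub>R (x s j - x s i) \<partial>I_leb))"
        by (rule AE_lebesgue_on_subset[OF deriv]) auto
      ultimately show ?thesis
      proof eventually_elim
        case (elim s)
        then obtain v where v: "has_L2_time_derivative x v s"
          "AE i in I_leb.
           integrable I_leb (\<lambda>j. (a s i j * \<phi> (norm (x s i - x s j))) *\<^sub>R (x s j - x s i)) \<and>
           v i = (\<integral>j. (a s i j * \<phi> (norm (x s i - x s j))) *\<^sub>R (x s j - x s i) \<partial>I_leb)"
          by (elim exE conjE)
        have "v \<in> L2_space I_leb"
          using v(1) by (simp add: has_L2_time_derivative_def)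
        with elim v dissipation[of s v] show ?case by auto
      qed
    qed
    from Q.energy_inequality[OF x _ _ int this] t
    have "G t - G 0 \<le> (\<integral>s. 2 * \<Phi> * G s \<partial>lebesgue_on {0..t})"
      by (simp add: G_def)
    also have "\<dots> = 2 * \<Phi> * integral {0..t} G"
      using lebesgue_integral_eq_integral[OF int] by simp
    finally show "G t \<le> 2 * \<Phi> * integral {0..t} G"
      by (simp add: G_0)
  qed (use \<Phi> in auto)
  then have "AE i in I_leb. (p T i)\<^sup>2 = 0"
    using integral_nonneg_eq_0_iff_AE[OF p2_int[OF T]] by (simp add: G_eq)
  then show ?thesis
    by eventually_elim (simp add: p_def max_def split: if_splits)
qed

text \<open>The half-space bound is applied to the finitely many directions \<open>b\<close> and
  \<open>- b\<close> of the basis, so the exceptional null sets can be united. The dimension enters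
  through the bound of the norm by the sum of the coordinates.\<close>

corollary graphon_solution_bounded:
  fixes x :: "real \<Rightarrow> real \<Rightarrow> 'b::euclidean_space"
    and R T :: real
  assumes sol: "graphon_solution a \<phi> x0 x"
    and a_range: "\<forall>t\<ge>0. \<forall>i\<in>{0..1}. \<forall>j\<in>{0..1}. a t i j \<in> {0..1}"
    and phi: "\<And>r. 0 \<le> r \<Longrightarrow> 0 \<le> \<phi> r" "\<And>r. 0 \<le> r \<Longrightarrow> \<phi> r \<le> \<Phi>"
    and R: "0 \<le> R" and init: "AE i in I_leb. norm (x0 i) \<le> R" and T: "0 \<le> T"
  shows "AE i in I_leb. norm (x T i) \<le> real DIM('b) * R"
proof -
  have bound: "AE i in I_leb. e \<bullet> x T i \<le> R" if e: "norm e = 1" for e :: 'b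
  proof (rule half_space_invariant)
    show "graphon_solution a \<phi> x0 x" by (rule sol)
    show "AE i in I_leb. e \<bullet> x0 i \<le> R"
      using init
    proof eventually_elim
      case (elim i)
      then show ?case using norm_cauchy_schwarz[of e "x0 i"] e by simp
    qed
  qed (use T R e phi a_range in auto)
  have "AE i in I_leb. \<forall>b\<in>Basis. \<bar>x T i \<bullet> b\<bar> \<le> R"
  proof (rule AE_finite_allI)
    fix b :: 'b assume b: "b \<in> Basis"
    from bound[of b] bound[of "- b"] b show "AE i in I_leb. \<bar>x T i \<bullet> b\<bar> \<le> R"
      by (auto elim!: eventually_elim2 simp: inner_commute abs_le_iff)
  qed simp
  then show ?thesis
  proof eventually_elim
    case (elim i)
    have "norm (x T i) \<le> (\<Sum>b\<in>Basis. \<bar>x T i \<bullet> b\<bar>)" by (rule norm_le_l1)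
    also have "\<dots> \<le> (\<Sum>b\<in>(Basis::'b set). R)" using elim by (intro sum_mono) auto
    finally show ?case by simp
  qed
qed

section \<open>The degree function\<close>


lemma AE_lborel_imp_lebesgue_on:
  assumes "AE x in lborel. P x" "S \<in> sets lebesgue"
  shows "AE x in lebesgue_on S. x \<in> S \<and> P x"
proof -
  have "AE x in lebesgue. P x"
    using assms(1) by (rule AE_completion)
  with assms(2) show ?thesis
    by (subst AE_restrict_space_iff) auto
qed

text \<open>Completeness of Lebesgue measure transfers measurability across a null set; extension by
  zero moves the question from \<open>S\<close> to the whole line.\<close>

lemma measurable_lebesgue_on_AE_cong:
  fixes f g :: "real \<Rightarrow> real"
  assumes S: "S \<in> sets lebesgue" and g: "g \<in> borel_measurable borel"
    and eq: "AE x in lebesgue_on S. f x = g x"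
  shows "f \<in> borel_measurable (lebesgue_on S)"
proof -
  have eq': "AE x in lebesgue. (if x \<in> S then g x else 0) = (if x \<in> S then f x else 0)"
  proof -
    have "AE x in lebesgue. x \<in> S \<longrightarrow> f x = g x"
      using eq S by (subst (asm) AE_restrict_space_iff) auto
    then show ?thesis by eventually_elim auto
  qed
  have "g \<in> borel_measurable (lebesgue_on S)"
    using g by (simp add: measurable_completion measurable_restrict_space1)
  then have g': "(\<lambda>x. if x \<in> S then g x else 0) \<in> borel_measurable lebesgue"
    using borel_measurable_if[OF S] by blast

  have "(\<lambda>x. if x \<in> S then f x else 0) \<in> borel_measurable lebesgue"
    using g' eq' by (rule borel_measurable_AE)
  then show ?thesis using borel_measurable_if[OF S] by blast
qed

text \<open>The version \<open>b\<close> of the degree function is Borel on \<open>\<real>\<^sup>2\<close>, so that Fubini's theorem applies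
  to it although \<open>a\<close> itself is only Lebesgue measurable.\<close>

lemma borel_degree:
  fixes a :: "real \<Rightarrow> real \<Rightarrow> real \<Rightarrow> real"
  assumes a_meas: "(\<lambda>(t, i, j). a t i j) \<in>
      borel_measurable (lebesgue_on ({0..} \<times> {0..1} \<times> {0..1}))"
    and a_range: "\<forall>t\<ge>0. \<forall>i\<in>{0..1}. \<forall>j\<in>{0..1}. a t i j \<in> {0..1}"
  obtains b :: "real \<Rightarrow> real \<Rightarrow> real" where
    "(\<lambda>(t, i). b t i) \<in> borel_measurable (borel \<Otimes>\<^sub>M borel)"
    "\<And>t i. 0 \<le> b t i" "\<And>t i. b t i \<le> 1"
    "AE t in lebesgue_on {0..}. AE i in I_leb. integrable I_leb (a t i) \<and> (\<integral>j. a t i j \<partial>I_leb) = b t i"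
    "AE i in I_leb. AE t in lebesgue_on {0..}. (\<integral>j. a t i j \<partial>I_leb) = b t i"
proof -
  interpret prob_space I_leb by (rule prob_space_I_leb)
  let ?S = "{0..} \<times> {0..1} \<times> {0..1} :: (real \<times> real \<times> real) set"
  \<comment> \<open>Extension by zero gives a function on the whole space, which agrees almost
    everywhere with a Borel function.\<close>
  define f where "f z = (if z \<in> ?S then (\<lambda>(t, i, j). a t i j) z else 0)" for z
  have "closed ?S"
    by (intro closed_Times) auto
  then have "?S \<in> sets lebesgue" by auto
  then have "f \<in> borel_measurable lebesgue"
    unfolding f_def using a_meas by (subst borel_measurable_if) auto
  then obtain g where g: "g \<in> borel_measurable lborel" "AE z in lborel. f z = g z"
    using completion_ex_borel_measurable_real by blast
  \<comment> \<open>Truncation keeps the Borel representative in the unit interval everywhere, so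
    all its sections are integrable; it changes nothing where the representative agrees with
    \<open>a\<close>.\<close>
  define h where "h z = max 0 (min 1 (g z))" for z
  have h_meas: "h \<in> borel_measurable borel"
    using g(1) unfolding h_def by simp
  have h_range: "0 \<le> h z" "h z \<le> 1" for z
    by (auto simp: h_def)
  have h_meas' [measurable]: "(\<lambda>j. h (t, i, j)) \<in> borel_measurable borel" for t i
    using h_meas by (rule measurable_compose[rotated]) (simp add: borel_prod[symmetric])
  obtain N where N: "N \<in> null_sets lborel" "{z. f z \<noteq> g z} \<subseteq> N"
    using g(2) by (auto simp: eventually_ae_filter)
  have N_sets [measurable]: "N \<in> sets (borel \<Otimes>\<^sub>M (borel \<Otimes>\<^sub>M borel))"
    using N(1) unfolding borel_prod by (simp add: null_sets_def)
  interpret P: pair_sigma_finite "lborel :: real measure" "lborel \<Otimes>\<^sub>M lborel :: (real \<times> real) measure"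
    unfolding lborel_prod ..
  \<comment> \<open>\<open>W\<close> collects the pairs whose section of the exceptional Borel set
    \<open>N\<close> is null. Its measurability permits the two almost-everywhere quantifiers over
    \<open>t\<close> and \<open>i\<close> to be exchanged.\<close>
  define W where "W = {ti. AE j in lborel. (fst ti, snd ti, j) \<notin> N}"
  have W_sets: "W \<in> sets (lborel \<Otimes>\<^sub>M lborel)"
  proof -
    define N' where "N' = {z. (fst (fst z), snd (fst z), snd z :: real) \<in> N}"
    have N': "N' \<in> sets ((lborel \<Otimes>\<^sub>M lborel) \<Otimes>\<^sub>M lborel)"
    proof -
      have "(\<lambda>z. (fst (fst z), snd (fst z), snd z)) \<in>
          measurable ((lborel \<Otimes>\<^sub>M lborel) \<Otimes>\<^sub>M lborel) (borel \<Otimes>\<^sub>M (borel \<Otimes>\<^sub>M borel))"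
        by measurable
      from measurable_sets[OF this N_sets] show ?thesis
        by (simp add: N'_def vimage_def space_pair_measure)
    qed
    have "(AE j in lborel. (fst x, snd x, j) \<notin> N) \<longleftrightarrow> emeasure lborel (Pair x -` N') = 0" for x
      using sets_Pair1[OF N', of x] by (intro AE_iff_measurable) (auto simp: N'_def)
    then have W: "W = (\<lambda>x. emeasure lborel (Pair x -` N')) -` {0} \<inter> space (lborel \<Otimes>\<^sub>M lborel)"
      by (auto simp: W_def space_pair_measure)
    have "(\<lambda>x. emeasure lborel (Pair x -` N')) \<in> borel_measurable (lborel \<Otimes>\<^sub>M lborel)"
      by (rule lborel.measurable_emeasure_Pair[OF N'])
    then show ?thesis
      unfolding W by (rule measurable_sets) simp
  qed
  have W1: "AE t in lborel. AE i in lborel. (t, i) \<in> W"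
  proof -
    have "AE z in lborel \<Otimes>\<^sub>M (lborel \<Otimes>\<^sub>M lborel). z \<notin> N"
      using N(1) by (simp add: lborel_prod AE_not_in)
    then have "AE t in lborel. AE ij in lborel \<Otimes>\<^sub>M lborel. (t, ij) \<notin> N"
      by (rule P.AE_pair)
    then show ?thesis
    proof eventually_elim
      case (elim t)
      then have "AE i in lborel. AE j in lborel. (t, i, j) \<notin> N"
        by (rule lborel_pair.AE_pair)
      then show ?case by (simp add: W_def)
    qed
  qed
  have W2: "AE i in lborel. AE t in lborel. (t, i) \<in> W"
  proof -
    have "{x \<in> space (lborel \<Otimes>\<^sub>M lborel). (fst x, snd x) \<in> W} \<in> sets (lborel \<Otimes>\<^sub>M lborel)"
      using W_sets by (simp add: space_pair_measure)
    from lborel_pair.AE_commute[OF this] W1 show ?thesis by blast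
  qed
  define b where "b t i = (\<integral>j. h (t, i, j) \<partial>I_leb)" for t i
  have h_int: "integrable I_leb (\<lambda>j. h (t, i, j))" for t i
    using h_range by (intro integrable_const_bound[of _ 1])
      (auto intro!: measurable_restrict_space1 measurable_completion)
  \<comment> \<open>On \<open>W\<close> the section of \<open>a\<close> agrees almost everywhere
    with that of \<open>h\<close>, so it is measurable by completeness and has the same
    integral.\<close>
  have key: "integrable I_leb (a t i) \<and> (\<integral>j. a t i j \<partial>I_leb) = b t i"
    if t: "0 \<le> t" and i: "i \<in> {0..1}" and W: "(t, i) \<in> W" for t i
  proof -
    have "AE j in lborel. (t, i, j) \<notin> N"
      using W by (simp add: W_def)
    then have "AE j in I_leb. j \<in> {0..1} \<and> (t, i, j) \<notin> N"
      by (rule AE_lborel_imp_lebesgue_on) simp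
    then have eq: "AE j in I_leb. a t i j = h (t, i, j)"
    proof eventually_elim
      case (elim j)
      then have "f (t, i, j) = g (t, i, j)" using N(2) by auto
      moreover have "f (t, i, j) = a t i j" using t i elim by (simp add: f_def)
      moreover have "0 \<le> a t i j" "a t i j \<le> 1" using a_range t i elim by auto
      ultimately show ?case by (simp add: h_def)
    qed
    have a: "a t i \<in> borel_measurable I_leb"
      by (rule measurable_lebesgue_on_AE_cong[OF _ h_meas' eq]) simp
    have h: "(\<lambda>j. h (t, i, j)) \<in> borel_measurable I_leb"
      using h_int by (rule borel_measurable_integrable)
    from a h eq h_int[of t i] show ?thesis
      unfolding b_def using integrable_cong_AE[OF a h eq] integral_cong_AE[OF a h eq] by simp
  qed
  show thesis
  proof
    have "(\<lambda>(ti, j). h (fst ti, snd ti, j)) \<in> borel_measurable ((borel \<Otimes>\<^sub>M borel) \<Otimes>\<^sub>M I_leb)"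
    proof -
      have "(\<lambda>(ti, j). (fst ti, snd ti, j)) \<in> measurable ((borel \<Otimes>\<^sub>M borel) \<Otimes>\<^sub>M I_leb) (borel \<Otimes>\<^sub>M (borel \<Otimes>\<^sub>M borel))"
      proof -
        have [measurable]: "(\<lambda>j. j) \<in> measurable I_leb borel"
          by (auto intro!: measurable_restrict_space1 measurable_completion)
        show ?thesis by measurable
      qed
      moreover have "h \<in> borel_measurable (borel \<Otimes>\<^sub>M (borel \<Otimes>\<^sub>M borel))"
        using h_meas unfolding borel_prod .
      ultimately show ?thesis
        unfolding split_beta' by (rule measurable_compose)
    qed
    from borel_measurable_lebesgue_integral[OF this]
    show "(\<lambda>(t, i). b t i) \<in> borel_measurable (borel \<Otimes>\<^sub>M borel)"
      by (simp add: b_def split_beta')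
    show "0 \<le> b t i" for t i
      unfolding b_def using h_range by (intro integral_nonneg_AE) auto
    show "b t i \<le> 1" for t i
      unfolding b_def using h_range h_int by (intro integral_le_const) auto
    show "AE t in lebesgue_on {0..}. AE i in I_leb.
        integrable I_leb (a t i) \<and> (\<integral>j. a t i j \<partial>I_leb) = b t i"
    proof -
      have "AE t in lebesgue_on {0..}. t \<in> {0..} \<and> (AE i in lborel. (t, i) \<in> W)"
        by (rule AE_lborel_imp_lebesgue_on[OF W1]) simp
      then show ?thesis
      proof eventually_elim
        case (elim t)
        then have "AE i in I_leb. i \<in> {0..1} \<and> (t, i) \<in> W"
          by (intro AE_lborel_imp_lebesgue_on) auto
        then show ?case by eventually_elim (use elim key in auto)
      qed
    qed
    show "AE i in I_leb. AE t in lebesgue_on {0..}. (\<integral>j. a t i j \<partial>I_leb) = b t i"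
    proof -
      have "AE i in I_leb. i \<in> {0..1} \<and> (AE t in lborel. (t, i) \<in> W)"
        by (rule AE_lborel_imp_lebesgue_on[OF W2]) simp
      then show ?thesis
      proof eventually_elim
        case (elim i)
        then have "AE t in lebesgue_on {0..}. t \<in> {0..} \<and> (t, i) \<in> W"
          by (intro AE_lborel_imp_lebesgue_on) auto
        then show ?case by eventually_elim (use elim key in auto)
      qed
    qed
  qed
qed

section \<open>Pointwise energy inequality\<close>


text \<open>The Taylor expansion of a squared distance is exact, and its remainder is
  \<open>(norm (y - z))\<^sup>2\<close>.\<close>

lemma distance_quadratic_functional:
  fixes c :: "'b::euclidean_space"
  assumes "\<theta> \<in> borel_measurable I_leb" "\<And>i. 0 \<le> \<theta> i" "\<And>i. \<theta> i \<le> 1"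
  shows "quadratic_functional \<theta> (\<lambda>z. (norm (z - c))\<^sup>2) (\<lambda>z. 2 *\<^sub>R (z - c)) (2 * norm c)"
proof
  fix y z :: 'b
  have "(norm (y - c))\<^sup>2 - (norm (z - c))\<^sup>2 - (2 *\<^sub>R (z - c)) \<bullet> (y - z) = (norm (y - z))\<^sup>2"
    unfolding power2_norm_eq_inner by (simp add: inner_diff_left inner_diff_right inner_commute)
  then show "\<bar>(norm (y - c))\<^sup>2 - (norm (z - c))\<^sup>2 - (2 *\<^sub>R (z - c)) \<bullet> (y - z)\<bar> \<le> (norm (y - z))\<^sup>2"
    by simp
  show "norm (2 *\<^sub>R (z - c)) \<le> 2 * norm z + 2 * norm c"
    using norm_triangle_ineq4[of z c] by simp
qed (use assms in auto)

text \<open>The weight to test with is the indicator of \<open>0 < f i\<close>: the product is then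
  nonnegative with nonpositive integral, hence zero almost everywhere.\<close>

lemma AE_le_0_if_weighted_integrals_le_0:
  fixes f :: "'a \<Rightarrow> real"
  assumes f: "integrable M f"
    and le: "\<And>\<theta>. \<lbrakk>\<theta> \<in> borel_measurable M; \<And>i. 0 \<le> \<theta> i; \<And>i. \<theta> i \<le> 1\<rbrakk> \<Longrightarrow>
      (\<integral>i. \<theta> i * f i \<partial>M) \<le> (0::real)"
  shows "AE i in M. f i \<le> 0"
proof -
  note [measurable] = borel_measurable_integrable[OF f]
  define \<theta> where "\<theta> i = (if 0 < f i then 1 else 0 :: real)" for i
  have \<theta> [measurable]: "\<theta> \<in> borel_measurable M"
    unfolding \<theta>_def by measurable
  have int: "integrable M (\<lambda>i. \<theta> i * f i)"
    by (rule Bochner_Integration.integrable_bound[OF f]) (auto simp: \<theta>_def)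
  have "(\<integral>i. \<theta> i * f i \<partial>M) \<le> 0"
    by (rule le) (auto simp: \<theta>_def \<theta>[unfolded \<theta>_def])
  moreover have nonneg: "0 \<le> \<theta> i * f i" for i
    by (simp add: \<theta>_def)
  ultimately have "(\<integral>i. \<theta> i * f i \<partial>M) = 0"
    by (intro antisym Bochner_Integration.integral_nonneg)
  then have "AE i in M. \<theta> i * f i = 0"
    using integral_nonneg_eq_0_iff_AE[OF int] nonneg by simp
  then show ?thesis
    by eventually_elim (simp add: \<theta>_def split: if_splits)
qed

text \<open>\<open>K\<close> bounds the deviation from \<open>c\<close>, so almost all mutual
  distances are at most \<open>2 * K\<close>; on that range \<open>\<kappa>\<close> is a lower bound
  of the interaction. \<open>b\<close> is an everywhere defined, jointly measurable version of the
  degree.\<close>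

locale bounded_graphon_solution =
  fixes a :: "real \<Rightarrow> real \<Rightarrow> real \<Rightarrow> real" and \<phi> :: "real \<Rightarrow> real"
    and x0 :: "real \<Rightarrow> 'b::euclidean_space" and x :: "real \<Rightarrow> real \<Rightarrow> 'b" and c :: 'b
    and b :: "real \<Rightarrow> real \<Rightarrow> real" and K \<Phi> \<kappa> :: real
  assumes sol: "graphon_solution a \<phi> x0 x"
    and a_range: "\<forall>t\<ge>0. \<forall>i\<in>{0..1}. \<forall>j\<in>{0..1}. a t i j \<in> {0..1}"
    and phi_le: "\<And>r. 0 \<le> r \<Longrightarrow> \<phi> r \<le> \<Phi>"
    and phi_nonneg: "\<And>r. 0 \<le> r \<Longrightarrow> 0 \<le> \<phi> r"
    and phi_ge: "\<And>r. 0 \<le> r \<Longrightarrow> r \<le> 2 * K \<Longrightarrow> \<kappa> \<le> \<phi> r"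
    and kappa: "0 < \<kappa>"
    and bounded: "\<And>t. 0 \<le> t \<Longrightarrow> AE i in I_leb. norm (x t i - c) \<le> K"
    and b_meas: "(\<lambda>(t, i). b t i) \<in> borel_measurable (borel \<Otimes>\<^sub>M borel)"
    and b_range: "\<And>t i. 0 \<le> b t i" "\<And>t i. b t i \<le> 1"
    and degree: "AE t in lebesgue_on {0..}. AE i in I_leb.
      integrable I_leb (a t i) \<and> (\<integral>j. a t i j \<partial>I_leb) = b t i"
begin

interpretation prob_space I_leb by (rule prob_space_I_leb)

lemma Phi_nonneg: "0 \<le> \<Phi>"
  using phi_nonneg[of 0] phi_le[of 0] by simp

lemma K_nonneg: "0 \<le> K"
proof -
  have "AE i in I_leb. 0 \<le> K"
    using bounded[OF order_refl]
  proof eventually_elim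
    case (elim i)
    then show ?case by (rule order_trans[OF norm_ge_zero])
  qed
  then show ?thesis
    by simp
qed

lemma Lip: "x \<in> Lip_loc_L2"
  using sol by (simp add: graphon_solution_def)

lemma L2_deviation: "0 \<le> t \<Longrightarrow> (\<lambda>i. x t i - c) \<in> L2_space I_leb"
  by (rule L2_space_diff[OF Lip_loc_L2_space[OF Lip]]) (auto simp: L2_space_def)

lemma L1_le_L2:
  assumes t: "0 \<le> t"
  shows "integrable I_leb (\<lambda>i. norm (x t i - c))"
    and "(\<integral>i. norm (x t i - c) \<partial>I_leb) \<le> L2_norm I_leb (\<lambda>i. x t i - c)"
proof -
  \<comment> \<open>Cauchy-Schwarz is stated for two vector-valued functions, so a constant basis
    vector, of norm one, serves as the second factor.\<close>
  have one: "(\<lambda>_. SOME e. e \<in> Basis :: 'b) \<in> L2_space I_leb"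
    by (simp add: L2_space_def)
  have norm_one: "norm (SOME e. e \<in> Basis :: 'b) = 1"
    using SOME_Basis by (rule norm_Basis)
  have "L2_norm I_leb (\<lambda>_::real. SOME e. e \<in> Basis :: 'b) = 1"
    using prob_space by (simp add: L2_norm_def norm_one)
  then show "integrable I_leb (\<lambda>i. norm (x t i - c))"
    "(\<integral>i. norm (x t i - c) \<partial>I_leb) \<le> L2_norm I_leb (\<lambda>i. x t i - c)"
    using integrable_norm_mult_L2[OF L2_deviation[OF t] one]
      integral_norm_mult_le[OF L2_deviation[OF t] one]
    by (simp_all add: norm_one)
qed

text \<open>Writing \<open>x t j - x t i\<close> as a difference of deviations from \<open>c\<close>
  separates a cross term from a damping term. The cross term integrates to at most
  \<open>\<Phi> * K * \<eta>\<close>, since the mean deviation is below its \<open>L2_norm\<close>;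
  the damping keeps the factor \<open>\<kappa> * b t i\<close>.\<close>

lemma velocity_bound:
  assumes "0 \<le> t0" and \<eta>: "\<And>t. t \<in> {t0..t1} \<Longrightarrow> L2_norm I_leb (\<lambda>i. x t i - c) \<le> \<eta>"
  shows "AE t in lebesgue_on {t0..t1}. \<exists>v. has_L2_time_derivative x v t \<and>
    (AE i in I_leb. (2 *\<^sub>R (x t i - c)) \<bullet> v i
      \<le> 2 * \<Phi> * K * \<eta> - 2 * \<kappa> * b t i * (norm (x t i - c))\<^sup>2)"
proof -
  have deriv: "AE t in lebesgue_on {0..}. \<exists>v. has_L2_time_derivative x v t \<and>
        (AE i in I_leb.
           integrable I_leb (\<lambda>j. (a t i j * \<phi> (norm (x t i - x t j))) *\<^sub>R (x t j - x t i)) \<and>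
           v i = (\<integral>j. (a t i j * \<phi> (norm (x t i - x t j))) *\<^sub>R (x t j - x t i) \<partial>I_leb))"
    using sol by (simp add: graphon_solution_def)
  have sub: "{t0..t1} \<subseteq> {0..}" using \<open>0 \<le> t0\<close> by auto
  have "AE t in lebesgue_on {t0..t1}. t \<in> {t0..t1}"
    by (rule AE_I2) simp
  moreover have "AE t in lebesgue_on {t0..t1}. \<exists>v. has_L2_time_derivative x v t \<and>
        (AE i in I_leb.
           integrable I_leb (\<lambda>j. (a t i j * \<phi> (norm (x t i - x t j))) *\<^sub>R (x t j - x t i)) \<and>
           v i = (\<integral>j. (a t i j * \<phi> (norm (x t i - x t j))) *\<^sub>R (x t j - x t i) \<partial>I_leb))"
    by (rule AE_lebesgue_on_subset[OF deriv sub]) auto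
  moreover have "AE t in lebesgue_on {t0..t1}. AE i in I_leb.
      integrable I_leb (a t i) \<and> (\<integral>j. a t i j \<partial>I_leb) = b t i"
    by (rule AE_lebesgue_on_subset[OF degree sub]) auto
  ultimately show ?thesis
  proof eventually_elim
    case (elim t)
    have t: "0 \<le> t" using elim(1) \<open>0 \<le> t0\<close> by simp
    from elim(2) obtain v where v: "has_L2_time_derivative x v t"
      and v_eq: "AE i in I_leb.
           integrable I_leb (\<lambda>j. (a t i j * \<phi> (norm (x t i - x t j))) *\<^sub>R (x t j - x t i)) \<and>
           v i = (\<integral>j. (a t i j * \<phi> (norm (x t i - x t j))) *\<^sub>R (x t j - x t i) \<partial>I_leb)"
      by (elim exE conjE)
    have "AE i in I_leb. i \<in> {0..1}"
      by (rule AE_I2) simp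
    with v_eq elim(3) bounded[OF t]
    have "AE i in I_leb. (2 *\<^sub>R (x t i - c)) \<bullet> v i
        \<le> 2 * \<Phi> * K * \<eta> - 2 * \<kappa> * b t i * (norm (x t i - c))\<^sup>2"
    proof eventually_elim
      case (elim i)
      let ?w = "\<lambda>j. a t i j * \<phi> (norm (x t i - x t j))"
      let ?f = "\<lambda>j. ?w j *\<^sub>R (x t j - x t i)"
      let ?z = "\<lambda>j. norm (x t j - c)"
      have f: "integrable I_leb ?f" and vi: "v i = (\<integral>j. ?f j \<partial>I_leb)"
        and ai: "integrable I_leb (a t i)" "(\<integral>j. a t i j \<partial>I_leb) = b t i"
        using elim by auto
      have "(x t i - c) \<bullet> v i = (\<integral>j. (x t i - c) \<bullet> ?f j \<partial>I_leb)"
        unfolding vi by (rule integral_inner_right[symmetric]) (rule f)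
      also have "\<dots> \<le> (\<integral>j. \<Phi> * ?z i * ?z j - \<kappa> * (?z i)\<^sup>2 * a t i j \<partial>I_leb)"
      proof (rule integral_mono_AE)
        show "integrable I_leb (\<lambda>j. (x t i - c) \<bullet> ?f j)"
          by (intro integrable_inner_right f)
        show "integrable I_leb (\<lambda>j. \<Phi> * ?z i * ?z j - \<kappa> * (?z i)\<^sup>2 * a t i j)"
          using L1_le_L2(1)[OF t] ai(1) by simp
        have "AE j in I_leb. j \<in> {0..1}"
          by (rule AE_I2) simp
        with bounded[OF t] show "AE j in I_leb. (x t i - c) \<bullet> ?f j
            \<le> \<Phi> * ?z i * ?z j - \<kappa> * (?z i)\<^sup>2 * a t i j"
        proof eventually_elim
          case (elim j)
          have a: "0 \<le> a t i j" "a t i j \<le> 1"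
            using a_range t elim \<open>i \<in> {0..1}\<close> by auto
          have "norm (x t i - x t j) \<le> 2 * K"
            using norm_triangle_ineq4[of "x t i - c" "x t j - c"] elim \<open>?z i \<le> K\<close> by simp
          then have phi: "\<kappa> \<le> \<phi> (norm (x t i - x t j))" "\<phi> (norm (x t i - x t j)) \<le> \<Phi>"
            using phi_ge phi_le by auto
          have w: "0 \<le> ?w j" "?w j \<le> \<Phi>" "\<kappa> * a t i j \<le> ?w j"
            using a phi kappa mult_mono[OF a(2) phi(2)] mult_right_mono[OF phi(1) a(1)]
            by (auto simp: mult.commute)
          have "(x t i - c) \<bullet> (x t j - x t i) = (x t i - c) \<bullet> (x t j - c) - (?z i)\<^sup>2"
            unfolding power2_norm_eq_inner by (simp add: inner_diff_left inner_diff_right)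
          also have "\<dots> \<le> ?z i * ?z j - (?z i)\<^sup>2"
            using norm_cauchy_schwarz[of "x t i - c" "x t j - c"] by simp
          finally have "(x t i - c) \<bullet> ?f j \<le> ?w j * (?z i * ?z j - (?z i)\<^sup>2)"
            using w(1) by (simp add: mult_left_mono)
          also have "\<dots> = ?w j * (?z i * ?z j) - ?w j * (?z i)\<^sup>2"
            by (simp add: right_diff_distrib)
          \<comment> \<open>The weight is bounded above in front of the nonnegative product, and
            below in front of the square that is subtracted.\<close>
          also have "\<dots> \<le> \<Phi> * (?z i * ?z j) - \<kappa> * a t i j * (?z i)\<^sup>2"
            using w by (intro diff_mono mult_right_mono) auto
          finally show ?case
            by (simp add: mult_ac)
        qed
      qed
      also have "\<dots> = \<Phi> * ?z i * (\<integral>j. ?z j \<partial>I_leb) - \<kappa> * (?z i)\<^sup>2 * b t i"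
        using L1_le_L2(1)[OF t] ai by simp
      also have "\<dots> \<le> \<Phi> * K * \<eta> - \<kappa> * (?z i)\<^sup>2 * b t i"
      proof -
        have "(\<integral>j. ?z j \<partial>I_leb) \<le> \<eta>"
          using L1_le_L2(2)[OF t] \<eta>[OF \<open>t \<in> {t0..t1}\<close>] by linarith
        then have "\<Phi> * ?z i * (\<integral>j. ?z j \<partial>I_leb) \<le> \<Phi> * K * \<eta>"
          using elim Phi_nonneg K_nonneg by (intro mult_mono mult_nonneg_nonneg Bochner_Integration.integral_nonneg) auto
        then show ?thesis by simp
      qed
      finally show ?case
        by (simp add: mult_ac)
    qed
    with v show ?case by blast
  qed
qed

lemma b_section_meas: "b t \<in> borel_measurable I_leb"
  and b_section_meas': "(\<lambda>t. b t i) \<in> borel_measurable (lebesgue_on S)"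
proof -
  have "b t \<in> borel_measurable borel" "(\<lambda>t. b t i) \<in> borel_measurable borel"
    using b_meas by measurable
  then show "b t \<in> borel_measurable I_leb" "(\<lambda>t. b t i) \<in> borel_measurable (lebesgue_on S)"
    by (auto intro!: measurable_restrict_space1 measurable_completion)
qed

text \<open>In the damping term the squared deviation is replaced by a lower bound \<open>u\<close>
  that does not depend on time, so that \<open>u i\<close> leaves the time integral and only the
  integrated degree remains. The estimate is proved in weighted form, and varying the weight gives
  it for almost every \<open>i\<close>. Boundedness of \<open>u\<close> provides the integrability
  for Fubini.\<close>

lemma pointwise_energy_inequality:
  assumes t: "0 \<le> t0" "t0 \<le> t1"
    and \<eta>: "\<And>t. t \<in> {t0..t1} \<Longrightarrow> L2_norm I_leb (\<lambda>i. x t i - c) \<le> \<eta>"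
    and u [measurable]: "u \<in> borel_measurable I_leb" and u_bdd: "\<And>i. \<bar>u i\<bar> \<le> U"
    and u_le: "\<And>t. t \<in> {t0..t1} \<Longrightarrow> AE i in I_leb. u i \<le> (norm (x t i - c))\<^sup>2"
  shows "AE i in I_leb. (norm (x t1 i - c))\<^sup>2 \<le> (norm (x t0 i - c))\<^sup>2
    + 2 * \<Phi> * K * \<eta> * (t1 - t0) - 2 * \<kappa> * u i * (\<integral>t. b t i \<partial>lebesgue_on {t0..t1})"
proof -
  let ?T = "lebesgue_on {t0..t1}"
  define C where "C = 2 * \<Phi> * K * \<eta>"
  define B where "B i = (\<integral>t. b t i \<partial>?T)" for i
  let ?s = "\<lambda>t i. (norm (x t i - c))\<^sup>2"
  interpret T: finite_measure ?T
    by (rule finite_measure_lebesgue_on) simp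
  interpret TI: pair_sigma_finite ?T I_leb ..
  interpret TI: finite_measure "?T \<Otimes>\<^sub>M I_leb"
    by (rule finite_measure_pair_measure) unfold_locales
  have b_TI [measurable]: "(\<lambda>(t, i). b t i) \<in> borel_measurable (?T \<Otimes>\<^sub>M I_leb)"
  proof -
    have "(\<lambda>(t, i). (t, i)) \<in> measurable (?T \<Otimes>\<^sub>M I_leb) (borel \<Otimes>\<^sub>M borel)"
    proof -
      have [measurable]: "(\<lambda>t. t) \<in> measurable (lebesgue_on S) borel" for S :: "real set"
        by (auto intro!: measurable_restrict_space1 measurable_completion)
      show ?thesis by measurable
    qed
    from measurable_compose[OF this b_meas] show ?thesis by (simp add: split_beta')
  qed
  note [measurable] = b_section_meas b_section_meas'
  have B_meas [measurable]: "B \<in> borel_measurable I_leb"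
  proof -
    have "(\<lambda>(i, t). b t i) \<in> borel_measurable (I_leb \<Otimes>\<^sub>M ?T)"
      using b_TI by (subst measurable_pair_swap_iff) (simp add: split_beta')
    from T.borel_measurable_lebesgue_integral[OF this] show ?thesis
      by (simp add: B_def[abs_def])
  qed
  have B_bdd: "\<bar>B i\<bar> \<le> measure ?T (space ?T)" for i
  proof -
    have "\<bar>B i\<bar> \<le> (\<integral>t. \<bar>b t i\<bar> \<partial>?T)"
      unfolding B_def using integral_norm_bound[of ?T "\<lambda>t. b t i"] by simp
    also have "\<dots> \<le> (\<integral>t. 1 \<partial>?T)"
      using b_range by (intro integral_mono T.integrable_const_bound[of _ 1]) auto
    finally show ?thesis by simp
  qed
  have s_int: "integrable I_leb (?s t)" if "0 \<le> t" for t
    using L2_spaceD(2)[OF L2_deviation[OF that]] .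
  have U: "0 \<le> U"
    using order_trans[OF abs_ge_zero u_bdd] .
  have uB_int: "integrable I_leb (\<lambda>i. u i * B i)"
  proof (rule integrable_const_bound)
    show "AE i in I_leb. norm (u i * B i) \<le> U * measure ?T (space ?T)"
      using u_bdd B_bdd U by (intro AE_I2) (auto simp: abs_mult intro!: mult_mono)
  qed measurable
  have weighted: "(\<integral>i. \<theta> i * (?s t1 i - ?s t0 i - C * (t1 - t0) + 2 * \<kappa> * (u i * B i)) \<partial>I_leb) \<le> 0"
    if \<theta> [measurable]: "\<theta> \<in> borel_measurable I_leb"
      and \<theta>_range: "\<And>i. 0 \<le> \<theta> i" "\<And>i. \<theta> i \<le> 1" for \<theta>
  proof -
    interpret Q: quadratic_functional \<theta> "\<lambda>z. (norm (z - c))\<^sup>2" "\<lambda>z. 2 *\<^sub>R (z - c)" "2 * norm c"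
      by (rule distance_quadratic_functional[OF that])
    have \<theta>_int: "integrable I_leb (\<lambda>i. \<theta> i * h i)" if "integrable I_leb h" for h
      by (rule Bochner_Integration.integrable_bound[OF that])
        (use \<theta>_range borel_measurable_integrable[OF that] in \<open>auto simp: abs_mult mult_left_le_one_le\<close>)
    have \<theta>_int1: "integrable I_leb \<theta>"
      using \<theta>_int[of "\<lambda>_. 1"] by simp
    \<comment> \<open>\<open>k\<close> is the weighted damping up to the factor
      \<open>2 * \<kappa>\<close>; it is bounded and jointly measurable on a product of finite
      measures, hence integrable.\<close>
    define k where "k t i = b t i * (\<theta> i * u i)" for t i
    have k_bdd: "norm (k t i) \<le> 1 * (1 * U)" for t i
    proof -
      have "b t i * (\<theta> i * \<bar>u i\<bar>) \<le> 1 * (1 * U)"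
        using b_range \<theta>_range u_bdd U by (intro mult_mono mult_nonneg_nonneg) auto
      then show ?thesis
        using b_range[of t i] \<theta>_range[of i] by (simp add: k_def abs_mult)
    qed
    have k_int: "integrable (?T \<Otimes>\<^sub>M I_leb) (\<lambda>(t, i). k t i)"
    proof (rule TI.integrable_const_bound)
      show "AE ti in ?T \<Otimes>\<^sub>M I_leb. norm ((\<lambda>(t, i). k t i) ti) \<le> 1 * (1 * U)"
        using k_bdd by (intro AE_I2) auto
      show "(\<lambda>(t, i). k t i) \<in> borel_measurable (?T \<Otimes>\<^sub>M I_leb)"
        unfolding k_def using b_TI by measurable
    qed
    have k_int': "integrable I_leb (k t)" for t
    proof (rule integrable_const_bound)
      show "AE i in I_leb. norm (k t i) \<le> 1 * (1 * U)"
        using k_bdd by (intro AE_I2) auto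
      show "k t \<in> borel_measurable I_leb"
        unfolding k_def[abs_def] by measurable
    qed
    define r where "r t = C * (\<integral>i. \<theta> i \<partial>I_leb) - 2 * \<kappa> * (\<integral>i. k t i \<partial>I_leb)" for t
    have r_int: "integrable ?T r"
      unfolding r_def using TI.integrable_fst[OF k_int] by simp
    have "AE t in ?T. t \<in> {t0..t1}"
      by (rule AE_I2) simp
    moreover have "AE t in ?T. \<exists>v. has_L2_time_derivative x v t \<and>
        (AE i in I_leb. (2 *\<^sub>R (x t i - c)) \<bullet> v i \<le> C - 2 * \<kappa> * b t i * ?s t i)"
      unfolding C_def by (rule velocity_bound[OF t(1)]) (rule \<eta>)
    ultimately have "AE t in ?T. \<exists>v. has_L2_time_derivative x v t \<and> Q.differential (x t) v \<le> r t"
    proof eventually_elim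
      case (elim t')
      then obtain v where v: "has_L2_time_derivative x v t'"
        and le: "AE i in I_leb. (2 *\<^sub>R (x t' i - c)) \<bullet> v i \<le> C - 2 * \<kappa> * b t' i * ?s t' i"
        by (elim exE conjE)
      have "0 \<le> t'" using elim t by simp
      have v2: "v \<in> L2_space I_leb"
        using v by (simp add: has_L2_time_derivative_def)
      have "Q.differential (x t') v \<le> (\<integral>i. C * \<theta> i - 2 * \<kappa> * k t' i \<partial>I_leb)"
        unfolding Q.differential_def
      proof (rule integral_mono_AE)
        show "integrable I_leb (\<lambda>i. \<theta> i * ((2 *\<^sub>R (x t' i - c)) \<bullet> v i))"
          by (rule Q.integrable_differential[OF Lip_loc_L2_space[OF Lip \<open>0 \<le> t'\<close>] v2])
        show "integrable I_leb (\<lambda>i. C * \<theta> i - 2 * \<kappa> * k t' i)"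
          using \<theta>_int1 k_int' by simp
        from le u_le[OF elim(1)]
        show "AE i in I_leb. \<theta> i * ((2 *\<^sub>R (x t' i - c)) \<bullet> v i) \<le> C * \<theta> i - 2 * \<kappa> * k t' i"
        proof eventually_elim
          case (elim i)
          have "2 * \<kappa> * b t' i * u i \<le> 2 * \<kappa> * b t' i * ?s t' i"
            using elim kappa b_range by (intro mult_left_mono) auto
          with elim(1) have "(2 *\<^sub>R (x t' i - c)) \<bullet> v i \<le> C - 2 * \<kappa> * b t' i * u i"
            by linarith
          then have "\<theta> i * ((2 *\<^sub>R (x t' i - c)) \<bullet> v i) \<le> \<theta> i * (C - 2 * \<kappa> * b t' i * u i)"
            using \<theta>_range by (intro mult_left_mono)
          also have "\<dots> = C * \<theta> i - 2 * \<kappa> * k t' i"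
            by (simp add: k_def algebra_simps)
          finally show ?case .
        qed
      qed
      also have "\<dots> = r t'"
        unfolding r_def using \<theta>_int1 k_int' by simp
      finally show ?case using v by blast
    qed
    from Q.energy_inequality[OF Lip t r_int this]
    have "(\<integral>i. \<theta> i * ?s t1 i \<partial>I_leb) - (\<integral>i. \<theta> i * ?s t0 i \<partial>I_leb) \<le> (\<integral>t. r t \<partial>?T)"
      by (simp add: Q.functional_def)
    also have "\<dots> = C * (t1 - t0) * (\<integral>i. \<theta> i \<partial>I_leb) - 2 * \<kappa> * (\<integral>t. \<integral>i. k t i \<partial>I_leb \<partial>?T)"
      unfolding r_def using TI.integrable_fst[OF k_int] t by (simp add: measure_restrict_space)
    \<comment> \<open>Exchanging the integrals puts time inside, where \<open>b\<close> integrates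
      to \<open>B i\<close>.\<close>
    also have "(\<integral>t. \<integral>i. k t i \<partial>I_leb \<partial>?T) = (\<integral>i. \<integral>t. k t i \<partial>?T \<partial>I_leb)"
      using TI.Fubini_integral[OF k_int] by simp
    also have "\<dots> = (\<integral>i. \<theta> i * (u i * B i) \<partial>I_leb)"
      by (intro Bochner_Integration.integral_cong) (auto simp: k_def B_def)
    finally have ineq: "(\<integral>i. \<theta> i * ?s t1 i \<partial>I_leb) - (\<integral>i. \<theta> i * ?s t0 i \<partial>I_leb)
        \<le> C * (t1 - t0) * (\<integral>i. \<theta> i \<partial>I_leb) - 2 * \<kappa> * (\<integral>i. \<theta> i * (u i * B i) \<partial>I_leb)" .
    have "(\<integral>i. \<theta> i * (?s t1 i - ?s t0 i - C * (t1 - t0) + 2 * \<kappa> * (u i * B i)) \<partial>I_leb)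
      = (\<integral>i. \<theta> i * ?s t1 i - \<theta> i * ?s t0 i - C * (t1 - t0) * \<theta> i + 2 * \<kappa> * (\<theta> i * (u i * B i)) \<partial>I_leb)"
      by (intro Bochner_Integration.integral_cong) (auto simp: algebra_simps)
    also have "\<dots> = (\<integral>i. \<theta> i * ?s t1 i \<partial>I_leb) - (\<integral>i. \<theta> i * ?s t0 i \<partial>I_leb)
        - C * (t1 - t0) * (\<integral>i. \<theta> i \<partial>I_leb) + 2 * \<kappa> * (\<integral>i. \<theta> i * (u i * B i) \<partial>I_leb)"
      using \<theta>_int[OF s_int] t \<theta>_int1 \<theta>_int[OF uB_int] by simp
    finally show ?thesis using ineq by linarith
  qed
  have "AE i in I_leb. ?s t1 i - ?s t0 i - C * (t1 - t0) + 2 * \<kappa> * (u i * B i) \<le> 0"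
  proof (rule AE_le_0_if_weighted_integrals_le_0[OF _ weighted])
    show "integrable I_leb (\<lambda>i. ?s t1 i - ?s t0 i - C * (t1 - t0) + 2 * \<kappa> * (u i * B i))"
      using s_int t uB_int by simp
  qed
  then show ?thesis
    by eventually_elim (simp add: C_def B_def algebra_simps)
qed

end

section \<open>Decay under persistence\<close>


context bounded_graphon_solution
begin

text \<open>The damping is estimated through the value at the end of the window, as in an implicit
  Euler step. With \<open>u\<close> equal to that value minus \<open>C * \<tau>\<close>, the energy
  inequality becomes \<open>u * (1 + 2 * \<kappa> * \<mu> * \<tau>) \<le> S\<close>, which explains
  the form of the factor.\<close>

lemma persistent_contraction:
  assumes t0: "0 \<le> t0" and \<tau>: "0 < \<tau>" and \<mu>: "0 < \<mu>" and \<eta>: "0 \<le> \<eta>"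
    and L2_le: "\<And>t. t \<in> {t0..t0 + \<tau>} \<Longrightarrow> L2_norm I_leb (\<lambda>i. x t i - c) \<le> \<eta>"
    and persistence: "AE i in I_leb. \<mu> * \<tau> \<le> (\<integral>t. b t i \<partial>lebesgue_on {t0..t0 + \<tau>})"
    and S: "0 \<le> S" "AE i in I_leb. (norm (x t0 i - c))\<^sup>2 \<le> S"
  shows "AE i in I_leb. (norm (x (t0 + \<tau>) i - c))\<^sup>2
    \<le> S / (1 + 2 * \<kappa> * \<mu> * \<tau>) + 2 * \<Phi> * K * \<eta> * \<tau>"
proof -
  let ?s = "\<lambda>t i. (norm (x t i - c))\<^sup>2"
  define t1 where "t1 = t0 + \<tau>"
  define C where "C = 2 * \<Phi> * K * \<eta>"
  have C: "0 \<le> C"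
    using Phi_nonneg K_nonneg \<eta> by (simp add: C_def)
  have C\<tau>: "0 \<le> C * \<tau>"
    using C \<tau> by simp
  have \<kappa>\<mu>\<tau>: "0 < \<kappa> * (\<mu> * \<tau>)"
    using kappa \<mu> \<tau> by simp
  \<comment> \<open>As \<open>s\<close> grows at most at rate \<open>C\<close>, its final value minus \<open>C * \<tau>\<close> bounds it below on the whole
    window; the truncation only serves to make \<open>u\<close> bounded everywhere.\<close>
  define u where "u i = min (?s t1 i) (K\<^sup>2) - C * \<tau>" for i
  have t1_meas: "(\<lambda>i. x t1 i - c) \<in> borel_measurable I_leb"
    using L2_spaceD(1)[OF L2_deviation[of t1]] t0 \<tau> by (simp add: t1_def)
  have u_le: "AE i in I_leb. u i \<le> ?s t i" if t: "t \<in> {t0..t1}" for t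
  proof -
    \<comment> \<open>The lower bound \<open>0\<close> in place of \<open>u\<close> removes the
      damping and leaves growth at rate at most \<open>C\<close>.\<close>
    have "AE i in I_leb. ?s t1 i \<le> ?s t i + 2 * \<Phi> * K * \<eta> * (t1 - t)
        - 2 * \<kappa> * 0 * (\<integral>s. b s i \<partial>lebesgue_on {t..t1})"
      by (rule pointwise_energy_inequality[where U = 0])
        (use t t0 L2_le in \<open>auto simp: t1_def\<close>)
    then show ?thesis
    proof eventually_elim
      case (elim i)
      have "C * (t1 - t) \<le> C * \<tau>"
        using t C by (intro mult_left_mono) (auto simp: t1_def)
      with elim show ?case by (simp add: u_def C_def)
    qed
  qed
  have "AE i in I_leb. ?s t1 i \<le> ?s t0 i + 2 * \<Phi> * K * \<eta> * (t1 - t0)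
      - 2 * \<kappa> * u i * (\<integral>s. b s i \<partial>lebesgue_on {t0..t1})"
  proof (rule pointwise_energy_inequality[OF t0 _ _ _ _ u_le])
    show "u \<in> borel_measurable I_leb"
      unfolding u_def[abs_def] using t1_meas by measurable
    show "\<bar>u i\<bar> \<le> K\<^sup>2 + C * \<tau>" for i
    proof -
      have "0 \<le> min (?s t1 i) (K\<^sup>2)" "min (?s t1 i) (K\<^sup>2) \<le> K\<^sup>2" by auto
      then show ?thesis unfolding u_def using C\<tau> by linarith
    qed
  qed (use \<tau> L2_le in \<open>auto simp: t1_def\<close>)
  moreover have "AE i in I_leb. norm (x t1 i - c) \<le> K"
    using t0 \<tau> by (intro bounded) (simp add: t1_def)
  moreover have "AE i in I_leb. \<mu> * \<tau> \<le> (\<integral>t. b t i \<partial>lebesgue_on {t0..t1})"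
    using persistence by (simp add: t1_def)
  ultimately have "AE i in I_leb. ?s t1 i \<le> S / (1 + 2 * \<kappa> * \<mu> * \<tau>) + C * \<tau>"
    using S(2)
  proof eventually_elim
    case (elim i)
    have "?s t1 i \<le> K\<^sup>2"
      using elim(2) by (intro power_mono) auto
    then have u: "u i = ?s t1 i - C * \<tau>"
      by (simp add: u_def)
    \<comment> \<open>The sign matters because the persistence bound is multiplied by
      \<open>u i\<close>. If \<open>u i\<close> is negative, the final value is below
      \<open>C * \<tau>\<close> already.\<close>
    show ?case
    proof (cases "0 \<le> u i")
      case True
      have "2 * \<kappa> * u i * (\<mu> * \<tau>) \<le> 2 * \<kappa> * u i * (\<integral>t. b t i \<partial>lebesgue_on {t0..t1})"
        using elim(3) True kappa by (intro mult_left_mono) auto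
      with elim(1,4) have "?s t1 i \<le> S + C * \<tau> - 2 * \<kappa> * u i * (\<mu> * \<tau>)"
        by (simp add: C_def t1_def)
      then have "u i * (1 + 2 * \<kappa> * \<mu> * \<tau>) \<le> S"
        unfolding u by (simp add: algebra_simps)
      then have "u i \<le> S / (1 + 2 * \<kappa> * \<mu> * \<tau>)"
        using \<kappa>\<mu>\<tau> by (subst pos_le_divide_eq) (auto simp: mult_ac)
      then show ?thesis by (simp add: u)
    next
      case False
      moreover have "0 \<le> S / (1 + 2 * \<kappa> * \<mu> * \<tau>)"
        using S(1) \<kappa>\<mu>\<tau> by (intro divide_nonneg_nonneg) (auto simp: mult_ac)
      ultimately show ?thesis by (simp add: u)
    qed
  qed
  then show ?thesis by (simp add: t1_def C_def)
qed

text \<open>Each window maps a bound \<open>S\<close> to \<open>q * S\<close> plus a constant error.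
  The second summand is the fixed point of this affine map, so induction multiplies only the first
  summand by \<open>q\<close>.\<close>

lemma persistent_decay:
  assumes t0: "0 \<le> t0" and \<tau>: "0 < \<tau>" and \<mu>: "0 < \<mu>" and \<eta>: "0 \<le> \<eta>"
    and L2_le: "\<And>t. t0 \<le> t \<Longrightarrow> L2_norm I_leb (\<lambda>i. x t i - c) \<le> \<eta>"
    and persistence: "\<And>t. 0 \<le> t \<Longrightarrow> AE i in I_leb. \<mu> * \<tau> \<le> (\<integral>s. b s i \<partial>lebesgue_on {t..t + \<tau>})"
  defines "q \<equiv> 1 / (1 + 2 * \<kappa> * \<mu> * \<tau>)"
  shows "AE i in I_leb. (norm (x (t0 + real n * \<tau>) i - c))\<^sup>2
    \<le> q ^ n * K\<^sup>2 + 2 * \<Phi> * K * \<eta> * \<tau> / (1 - q)"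
proof (induction n)
  have \<kappa>\<mu>\<tau>: "0 < 2 * \<kappa> * \<mu> * \<tau>"
    using kappa \<mu> \<tau> by simp
  then have q: "0 < q" "q < 1"
    unfolding q_def by (auto simp: field_simps)
  define C where "C = 2 * \<Phi> * K * \<eta> * \<tau>"
  have C: "0 \<le> C"
    using Phi_nonneg K_nonneg \<eta> \<tau> by (simp add: C_def)
  {
    case 0
    have "AE i in I_leb. norm (x t0 i - c) \<le> K"
      using t0 by (rule bounded)
    then show ?case
    proof eventually_elim
      case (elim i)
      then have "(norm (x t0 i - c))\<^sup>2 \<le> K\<^sup>2"
        by (intro power_mono) auto
      moreover have "0 \<le> C / (1 - q)"
        using C q by simp
      ultimately show ?case by (simp add: C_def)
    qed
  next
    case (Suc n)
    let ?t = "t0 + real n * \<tau>"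
    let ?S = "q ^ n * K\<^sup>2 + C / (1 - q)"
    have t: "t0 \<le> ?t"
      using \<tau> by simp
    have "AE i in I_leb. (norm (x (?t + \<tau>) i - c))\<^sup>2 \<le> ?S / (1 + 2 * \<kappa> * \<mu> * \<tau>) + 2 * \<Phi> * K * \<eta> * \<tau>"
    proof (rule persistent_contraction[OF _ \<tau> \<mu> \<eta>])
      show "0 \<le> ?S"
        using C q by simp
      show "AE i in I_leb. (norm (x ?t i - c))\<^sup>2 \<le> ?S"
        using Suc unfolding C_def .
      show "L2_norm I_leb (\<lambda>i. x t i - c) \<le> \<eta>" if "t \<in> {?t..?t + \<tau>}" for t
        by (intro L2_le order_trans[OF t]) (use that in simp)
      show "0 \<le> ?t" "AE i in I_leb. \<mu> * \<tau> \<le> (\<integral>s. b s i \<partial>lebesgue_on {?t..?t + \<tau>})"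
        using t t0 by (auto intro!: persistence)
    qed
    moreover have "?S / (1 + 2 * \<kappa> * \<mu> * \<tau>) + 2 * \<Phi> * K * \<eta> * \<tau> = q ^ Suc n * K\<^sup>2 + C / (1 - q)"
    proof -
      have "?S / (1 + 2 * \<kappa> * \<mu> * \<tau>) = q * ?S"
        by (simp add: q_def)
      moreover have "q * (C / (1 - q)) + C = C / (1 - q)"
        using q by (simp add: field_simps)
      ultimately show ?thesis
        by (simp add: C_def[symmetric] distrib_left)
    qed
    moreover have "?t + \<tau> = t0 + real (Suc n) * \<tau>"
      by (simp add: algebra_simps)
    ultimately show ?case
      by (simp add: C_def)
  }
qed

text \<open>The squared deviation is kept below \<open>\<epsilon>\<^sup>2\<close> by giving half to
  the geometric term, through the number \<open>n\<close> of windows, and half to the persistent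
  error, through the threshold \<open>\<eta>\<close>. Neither choice depends on the time.\<close>

lemma Linf_convergence:
  assumes \<tau>: "0 < \<tau>" and \<mu>: "0 < \<mu>"
    and persistence: "\<And>t. 0 \<le> t \<Longrightarrow> AE i in I_leb. \<mu> * \<tau> \<le> (\<integral>s. b s i \<partial>lebesgue_on {t..t + \<tau>})"
    and L2_lim: "((\<lambda>t. L2_norm I_leb (\<lambda>i. x t i - c)) \<longlongrightarrow> 0) at_top"
    and \<epsilon>: "0 < \<epsilon>"
  shows "\<forall>\<^sub>F t in at_top. AE i in I_leb. norm (x t i - c) \<le> \<epsilon>"
proof -
  define q where "q = 1 / (1 + 2 * \<kappa> * \<mu> * \<tau>)"
  have "0 < 2 * \<kappa> * \<mu> * \<tau>"
    using kappa \<mu> \<tau> by simp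
  then have q: "0 < q" "q < 1"
    unfolding q_def by (auto simp: field_simps)
  define D where "D = 2 * \<Phi> * K * \<tau> / (1 - q)"
  have D: "0 \<le> D"
    using Phi_nonneg K_nonneg \<tau> q by (simp add: D_def)
  \<comment> \<open>The summand \<open>1\<close> keeps the denominator positive when
    \<open>D = 0\<close>.\<close>
  define \<eta> where "\<eta> = \<epsilon>\<^sup>2 / (2 * (D + 1))"
  have \<eta>: "0 < \<eta>"
    using \<epsilon> D by (simp add: \<eta>_def)
  have D\<eta>: "D * \<eta> \<le> \<epsilon>\<^sup>2 / 2"
    using D \<epsilon> by (simp add: \<eta>_def field_simps)
  have "(\<lambda>n. q ^ n * K\<^sup>2) \<longlonglongrightarrow> 0 * K\<^sup>2"
    using q by (intro tendsto_intros LIMSEQ_power_zero) auto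
  then have "\<forall>\<^sub>F n in sequentially. q ^ n * K\<^sup>2 < \<epsilon>\<^sup>2 / 2"
    using \<epsilon> by (intro order_tendstoD(2)[where y = "0 * K\<^sup>2"]) auto
  then obtain n where n: "q ^ n * K\<^sup>2 < \<epsilon>\<^sup>2 / 2"
    by (auto simp: eventually_sequentially)
  have "\<forall>\<^sub>F t in at_top. L2_norm I_leb (\<lambda>i. x t i - c) < \<eta>"
    using L2_lim \<eta> by (rule order_tendstoD(2))
  then obtain T where T: "\<And>t. T \<le> t \<Longrightarrow> L2_norm I_leb (\<lambda>i. x t i - c) < \<eta>"
    by (auto simp: eventually_at_top_linorder)
  have "AE i in I_leb. norm (x t i - c) \<le> \<epsilon>" if t: "max 0 T + real n * \<tau> \<le> t" for t
  proof -
    \<comment> \<open>Starting exactly \<open>n\<close> windows before \<open>t\<close> reaches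
      every late time, not only those on a grid of step \<open>\<tau>\<close>.\<close>
    let ?t0 = "t - real n * \<tau>"
    have t0: "0 \<le> ?t0" "T \<le> ?t0"
      using t by auto
    have "AE i in I_leb. (norm (x (?t0 + real n * \<tau>) i - c))\<^sup>2
        \<le> q ^ n * K\<^sup>2 + 2 * \<Phi> * K * \<eta> * \<tau> / (1 - q)"
      unfolding q_def
      by (rule persistent_decay[OF t0(1) \<tau> \<mu> less_imp_le[OF \<eta>] _ persistence])
        (use T t0 in \<open>auto intro!: less_imp_le\<close>)
    then show ?thesis
    proof eventually_elim
      case (elim i)
      have "2 * \<Phi> * K * \<eta> * \<tau> / (1 - q) = D * \<eta>"
        by (simp add: D_def)
      with elim D\<eta> n have "(norm (x t i - c))\<^sup>2 \<le> \<epsilon>\<^sup>2" by simp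
      then show ?case
        by (rule power2_le_imp_le) (use \<epsilon> in simp)
    qed
  qed
  then show ?thesis
    unfolding eventually_at_top_linorder by blast
qed

end

section \<open>Continuity of the interaction and comparison of the two norms\<close>

lemma locally_lipschitz_on_imp_continuous_on:
  assumes "locally_lipschitz_on S f"
  shows "continuous_on S f"
  unfolding continuous_on_eq_continuous_within
proof
  fix r assume r: "r \<in> S"
  then obtain u L where u: "0 < u" and L: "L-lipschitz_on (cball r u \<inter> S) f"
    using assms unfolding locally_lipschitz_on_def by blast
  have "continuous (at r within cball r u \<inter> S) f"
    using lipschitz_on_continuous_within[OF L] r u by simp
  moreover have "at r within cball r u \<inter> S = at r within S"
    using u by (intro at_within_nhd[of r "ball r u"]) auto
  ultimately show "continuous (at r within S) f"
    by (simp add: continuous_within)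
qed

lemma Linf_norm_le:
  assumes f: "f \<in> borel_measurable M" and le: "AE i in M. norm (f i) \<le> e"
  shows "Linf_norm M f \<le> ereal e"
  unfolding Linf_norm_def using f le by (intro esssup_I) auto

lemma Linf_norm_nonneg:
  assumes f: "f \<in> borel_measurable M" and M: "emeasure M (space M) \<noteq> 0"
  shows "0 \<le> Linf_norm M f"
proof -
  have "esssup M (\<lambda>_. 0 :: ereal) \<le> Linf_norm M f"
    unfolding Linf_norm_def using f by (intro esssup_mono) auto
  then show ?thesis
    by (simp add: esssup_const[OF M])
qed

lemma AE_norm_le_of_Linf_norm:
  assumes "Linf_norm M f \<le> ereal e"
  shows "AE i in M. norm (f i) \<le> e"
proof -
  have "AE i in M. ereal (norm (f i)) \<le> Linf_norm M f"
    unfolding Linf_norm_def by (rule esssup_AE)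
  then show ?thesis
  proof eventually_elim
    case (elim i)
    then show ?case using order_trans[OF elim assms] by simp
  qed
qed

lemma L2_norm_le_of_AE_norm_le:
  assumes M: "prob_space M" and e: "0 \<le> e" and le: "AE i in M. norm (f i) \<le> e"
  shows "L2_norm M f \<le> e"
proof -
  interpret prob_space M by fact
  \<comment> \<open>If the square is not integrable, its Bochner integral is \<open>0\<close> by
    convention and the bound still holds.\<close>
  have "(\<integral>i. (norm (f i))\<^sup>2 \<partial>M) \<le> (\<integral>i. e\<^sup>2 \<partial>M)"
  proof (cases "integrable M (\<lambda>i. (norm (f i))\<^sup>2)")
    case True
    show ?thesis
    proof (rule integral_mono_AE[OF True])
      show "AE i in M. (norm (f i))\<^sup>2 \<le> e\<^sup>2"
        using le by eventually_elim (auto intro: power_mono)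
    qed simp
  qed (simp add: not_integrable_integral_eq prob_space)
  then show ?thesis
    using e by (auto simp: L2_norm_def prob_space intro: real_le_lsqrt)
qed

section \<open>Equivalence of the two modes of convergence\<close>

theorem theorem5p5:
  fixes x0 :: "real \<Rightarrow> real ^ 'd"
    and x :: "real \<Rightarrow> real \<Rightarrow> real ^ 'd"
    and a :: "real \<Rightarrow> real \<Rightarrow> real \<Rightarrow> real"
    and \<phi> :: "real \<Rightarrow> real"
    and R \<tau> \<mu> :: real
    and xinf :: "real ^ 'd"
  assumes x0: "x0 \<in> Linf_space I_leb"
    and R: "R > 0" "Linf_norm I_leb x0 \<le> ereal R"
    and a_meas: "(\<lambda>(t, i, j). a t i j) \<in>
                   borel_measurable (lebesgue_on ({0..} \<times> {0..1} \<times> {0..1}))"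
    and a_range: "\<forall>t\<ge>0. \<forall>i\<in>{0..1}. \<forall>j\<in>{0..1}. a t i j \<in> {0..1}"
    and phi_lip: "locally_lipschitz_on {0..} \<phi>"
    and phi_pos: "\<forall>r\<ge>0. \<phi> r > 0"
    and phi_bdd: "bounded (\<phi> ` {0..})"
    and sol: "graphon_solution a \<phi> x0 x"
    and tau: "\<tau> > 0"
    and mu: "\<mu> \<in> {0<..1}"
    and persistence: "\<forall>t\<ge>0. AE i in I_leb.
          (1 / \<tau>) * (\<integral>s. (\<integral>j. a s i j \<partial>I_leb) \<partial>(lebesgue_on {t..t + \<tau>})) \<ge> \<mu>"
    and xinf: "xinf \<in> closed_convex_hull_ess_range x0"
  shows "((\<lambda>t. Linf_norm I_leb (\<lambda>i. x t i - xinf)) \<longlongrightarrow> 0) at_top \<longleftrightarrow>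
         ((\<lambda>t. L2_norm I_leb (\<lambda>i. x t i - xinf)) \<longlongrightarrow> 0) at_top"
proof -
  interpret prob_space I_leb by (rule prob_space_I_leb)
  have Lip: "x \<in> Lip_loc_L2"
    using sol by (simp add: graphon_solution_def)
  have meas: "(\<lambda>i. x t i - xinf) \<in> borel_measurable I_leb" if "0 \<le> t" for t
    using L2_spaceD(1)[OF Lip_loc_L2_space[OF Lip that]] by measurable
  have Linf_nonneg: "0 \<le> Linf_norm I_leb (\<lambda>i. x t i - xinf)" if "0 \<le> t" for t
    using meas[OF that] by (rule Linf_norm_nonneg) (simp only: emeasure_space_1 one_neq_zero not_False_eq_True)
  show ?thesis
  proof
    assume lim: "((\<lambda>t. Linf_norm I_leb (\<lambda>i. x t i - xinf)) \<longlongrightarrow> 0) at_top"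
    show "((\<lambda>t. L2_norm I_leb (\<lambda>i. x t i - xinf)) \<longlongrightarrow> 0) at_top"
    proof (rule order_tendstoI)
      fix e :: real assume "e < 0"
      then show "\<forall>\<^sub>F t in at_top. e < L2_norm I_leb (\<lambda>i. x t i - xinf)"
        using less_le_trans[OF _ L2_norm_nonneg] by (intro always_eventually) blast
    next
      fix e :: real assume e: "0 < e"
      \<comment> \<open>Comparison of the norms yields only a non-strict bound; the half restores
        strictness.\<close>
      have "\<forall>\<^sub>F t in at_top. Linf_norm I_leb (\<lambda>i. x t i - xinf) < ereal (e / 2)"
        using lim by (rule order_tendstoD(2)) (use e in auto)
      then show "\<forall>\<^sub>F t in at_top. L2_norm I_leb (\<lambda>i. x t i - xinf) < e"
      proof eventually_elim
        case (elim t)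
        have "L2_norm I_leb (\<lambda>i. x t i - xinf) \<le> e / 2"
          using e AE_norm_le_of_Linf_norm[OF less_imp_le[OF elim]]
          by (intro L2_norm_le_of_AE_norm_le prob_space_I_leb) auto
        with e show ?case by simp
      qed
    qed
  next
    assume lim: "((\<lambda>t. L2_norm I_leb (\<lambda>i. x t i - xinf)) \<longlongrightarrow> 0) at_top"
    obtain b where b_meas: "(\<lambda>(t, i). b t i) \<in> borel_measurable (borel \<Otimes>\<^sub>M borel)"
      and b_range: "\<And>t i. 0 \<le> b t i" "\<And>t i. b t i \<le> 1"
      and degree: "AE t in lebesgue_on {0..}. AE i in I_leb.
        integrable I_leb (a t i) \<and> (\<integral>j. a t i j \<partial>I_leb) = b t i"
      and degree': "AE i in I_leb. AE t in lebesgue_on {0..}. (\<integral>j. a t i j \<partial>I_leb) = b t i"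
      by (rule borel_degree[OF a_meas a_range]) blast
    obtain \<Phi> where "\<forall>r\<in>{0..}. \<bar>\<phi> r\<bar> \<le> \<Phi>"
      using phi_bdd by (auto simp: bounded_iff)
    then have phi_le: "\<phi> r \<le> \<Phi>" if "0 \<le> r" for r
      using that order_trans[OF abs_ge_self, of "\<phi> r" \<Phi>] by simp
    have phi_nonneg: "0 \<le> \<phi> r" if "0 \<le> r" for r
      using phi_pos that by (simp add: less_imp_le)
    \<comment> \<open>The first summand bounds the solution for all times, the second accounts for
      the shift by \<open>xinf\<close>.\<close>
    define K where "K = real DIM(real ^ 'd) * R + norm xinf"
    have K: "0 \<le> K"
      using R by (simp add: K_def)
    have bounded: "AE i in I_leb. norm (x t i - xinf) \<le> K" if "0 \<le> t" for t
    proof -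
      have "AE i in I_leb. norm (x t i) \<le> real DIM(real ^ 'd) * R"
      proof (rule graphon_solution_bounded[OF sol a_range])
        show "AE i in I_leb. norm (x0 i) \<le> R"
          using R(2) by (rule AE_norm_le_of_Linf_norm)
      qed (use R that phi_nonneg phi_le in auto)
      then show ?thesis
      proof eventually_elim
        case (elim i)
        then show ?case
          using norm_triangle_ineq4[of "x t i" xinf] by (simp add: K_def)
      qed
    qed
    have "continuous_on {0..2 * K} \<phi>"
      using locally_lipschitz_on_imp_continuous_on[OF phi_lip] by (rule continuous_on_subset) auto
    \<comment> \<open>The minimum of \<open>\<phi>\<close> over the compact range of distances is
      attained, hence positive; it serves as \<open>\<kappa>\<close>.\<close>
    then obtain r0 where r0: "r0 \<in> {0..2 * K}" "\<And>r. r \<in> {0..2 * K} \<Longrightarrow> \<phi> r0 \<le> \<phi> r"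
      using continuous_attains_inf[of "{0..2 * K}" \<phi>] K by auto
    interpret bounded_graphon_solution a \<phi> x0 x xinf b K \<Phi> "\<phi> r0"
      by unfold_locales
        (use sol a_range phi_le phi_nonneg r0 phi_pos bounded b_meas b_range degree in auto)
    \<comment> \<open>The time integral is taken for fixed \<open>i\<close>, so the version
      \<open>degree'\<close>, with the quantifier over \<open>i\<close> outside, is the one that
      replaces the degree by \<open>b\<close>.\<close>
    have persistence': "AE i in I_leb. \<mu> * \<tau> \<le> (\<integral>s. b s i \<partial>lebesgue_on {t..t + \<tau>})"
      if t: "0 \<le> t" for t
      using persistence[rule_format, OF t] degree'
    proof eventually_elim
      case (elim i)
      have eq: "AE s in lebesgue_on {t..t + \<tau>}. (\<integral>j. a s i j \<partial>I_leb) = b s i"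
        by (rule AE_lebesgue_on_subset[OF elim(2)]) (use t in auto)
      have "(\<lambda>s. b s i) \<in> borel_measurable borel"
        using b_meas by measurable
      then have "(\<lambda>s. \<integral>j. a s i j \<partial>I_leb) \<in> borel_measurable (lebesgue_on {t..t + \<tau>})"
        by (intro measurable_lebesgue_on_AE_cong[OF _ _ eq]) auto
      then have "(\<integral>s. (\<integral>j. a s i j \<partial>I_leb) \<partial>lebesgue_on {t..t + \<tau>})
          = (\<integral>s. b s i \<partial>lebesgue_on {t..t + \<tau>})"
        using b_section_meas' eq by (rule integral_cong_AE)
      with elim(1) tau show ?case
        by (simp add: field_simps)
    qed
    show "((\<lambda>t. Linf_norm I_leb (\<lambda>i. x t i - xinf)) \<longlongrightarrow> 0) at_top"
    proof (rule order_tendstoI)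
      fix y :: ereal assume y: "y < 0"
      have "\<forall>\<^sub>F t::real in at_top. 0 \<le> t"
        by (rule eventually_ge_at_top)
      then show "\<forall>\<^sub>F t in at_top. y < Linf_norm I_leb (\<lambda>i. x t i - xinf)"
        by eventually_elim (use Linf_nonneg y in \<open>auto intro: less_le_trans\<close>)
    next
      fix y :: ereal assume "0 < y"
      then obtain e where e: "0 < ereal e" "ereal e < y"
        using ereal_dense2 by blast
      have "\<forall>\<^sub>F t in at_top. AE i in I_leb. norm (x t i - xinf) \<le> e"
        by (rule Linf_convergence[OF tau _ persistence' lim]) (use mu e in auto)
      moreover have "\<forall>\<^sub>F t::real in at_top. 0 \<le> t"
        by (rule eventually_ge_at_top)
      ultimately show "\<forall>\<^sub>F t in at_top. Linf_norm I_leb (\<lambda>i. x t i - xinf) < y"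
      proof eventually_elim
        case (elim t)
        have "Linf_norm I_leb (\<lambda>i. x t i - xinf) \<le> ereal e"
          by (rule Linf_norm_le[OF meas]) (use elim in auto)
        then show ?case using e(2) by (rule le_less_trans)
      qed
    qed
  qed
qed

end
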